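(* To equip a bicategory $B$ with duplicial structure is equivalently to give: (a) for each object $x\in B$ an object $tx\in B$ and a morphism $\epsilon_x\colon tx\to x$; (b) for each morphism $f\colon a\to x$ in $B$ a morphism $tf\colon tx\to a$ and a 2-cell $\epsilon_f\colon f\circ tf\Rightarrow\epsilon_x$ exhibiting $tf$ as a right lifting of $\epsilon_x$ through $f$; all subject to the conditions that, for every object $x$: (c) $t1_x=\epsilon_x$; (d) $t^21_x=1_{tx}$, where $t^21_x=t(t1_x)$; (e) $\epsilon_{t1_x}=1_{t(1_x)}$.
   Context: Duplicial structure on a bicategory $B$ means duplicial structure on its nerve $NB$, the simplicial set defined as follows. - 0-simplices are objects of $B$. - 1-simplices are arrows $f\colon x\to y$, with $d_0f=y$, $d_1f=x$. - 2-simplices are 2-cells $\alpha\colon g\circ f\Rightarrow h$ with $f\colon x\to y$, $g\colon y\to z$, $h\colon x\to z$; the faces are $d_0=g$, $d_1=h$, $d_2=f$. - 3-simplices consist of arrows $f\colon x\to y$, $g\colon y\to z$, $h\colon z\to w$, $k\colon x\to z$, $\ell\colon y\to w$, $m\colon x\to w$ and 2-cells $\alpha\colon hg\Rightarrow\ell$, $\beta\colon gf\Rightarrow k$, $\gamma\colon hk\Rightarrow m$, $\delta\colon\ell f\Rightarrow m$ such that $\delta\circ(\alpha f)=\gamma\circ(h\beta)\circ\mathrm{assoc}$, where $\mathrm{assoc}\colon(hg)f\cong h(gf)$ is the associativity constraint; the faces are $d_0=\alpha$, $d_1=\gamma$, $d_2=\delta$, $d_3=\beta$. - Higher simplices are determined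 by 3-coskeletality. - Degeneracies are given by identities and unit constraints: $s_0x=1_x$; for $f\colon a\to x$, $s_0f$ is the right unit constraint $f\circ1_a\Rightarrow f$ and $s_1f$ is the left unit constraint $1_x\circ f\Rightarrow f$; and so on. Duplicial structure on a simplicial set $X$, with faces $d_i$ and degeneracies $s_i$, consists of maps $t_n\colon X_n\to X_n$ for all $n\geq 0$ such that, for all $n\ge 0$: (1) $d_i t_{n+1}=t_n d_{i-1}$ for $1\le i\le n+1$, and $d_0t_{n+1}=d_{n+1}$; (2) $s_it_n=t_{n+1}s_{i-1}$ for $1\le i\le n$, and $s_0t_n=t_{n+1}^2s_n$. Given arrows $f\colon a\to b$, $h\colon b\to c$, $g\colon a\to c$ of a bicategory, a 2-cell $\alpha\colon h\circ f\Rightarrow g$ exhibits $f$ as a right lifting of $g$ through $h$ if every 2-cell $\beta\colon h\circ k\Rightarrow g$ with $k\colon a\to b$ is of the form $\alpha\circ(h\bar\beta)$ for a unique 2-cell $\bar\beta\colon k\Rightarrow f$. In condition (e), the 2-cell $\epsilon_{t1_x}$ has type $t1_x\circ t^21_x\Rightarrow\epsilon_x$, which by (c) and (d) is $t1_x\circ 1_{tx}\Rightarrow t1_x$; the equation is read with $t1_x\circ 1_{tx}$ identified with $t1_x$ by the right unit constraint of $B$ (an identity when the identities of $B$ are strict).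
   Formalization: As stated, (a)–(e) leave the 2-cell ε_{1_x} undetermined, so the bijection fails; the formal version adds that ε_{1_x} is the left unit constraint of ε_x, and shows any (a)–(e) data gives a unique duplicial structure after resetting ε_{1_x} to it. *)

theory Defs
  imports Main "HOL-Library.FuncSet"
begin

section \<open>Bicategories\<close>

text \<open>
  Both compositions are written in applicative order: \<open>g \<odot> f\<close> and \<open>\<beta> \<star> \<alpha>\<close> are
  \<open>f\<close> (resp. \<open>\<alpha>\<close>) followed by \<open>g\<close> (resp. \<open>\<beta>\<close>), and \<open>\<beta> \<cdot> \<alpha>\<close> is the vertical composite of \<open>\<alpha>\<close>
  followed by \<open>\<beta>\<close>. The operations are only meaningful on composable arguments taken from
  the carriers.
\<close>

record ('o, 'm, 'c) bicat =
  Obj    :: "'o set"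
  Arr    :: "'m set"
  src    :: "'m \<Rightarrow> 'o"
  tgt    :: "'m \<Rightarrow> 'o"
  Cell   :: "'c set"
  csrc   :: "'c \<Rightarrow> 'm"
  ctgt   :: "'c \<Rightarrow> 'm"
  idcell :: "'m \<Rightarrow> 'c"
  vcomp  :: "'c \<Rightarrow> 'c \<Rightarrow> 'c"  (infixr "\<cdot>\<index>" 65)
  idarr  :: "'o \<Rightarrow> 'm"
  comp   :: "'m \<Rightarrow> 'm \<Rightarrow> 'm"  (infixr "\<odot>\<index>" 70)
  hcomp  :: "'c \<Rightarrow> 'c \<Rightarrow> 'c"  (infixr "\<star>\<index>" 70)
  assoc  :: "'m \<Rightarrow> 'm \<Rightarrow> 'm \<Rightarrow> 'c"
  lunit  :: "'m \<Rightarrow> 'c"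
  runit  :: "'m \<Rightarrow> 'c"

definition arrow :: "('o, 'm, 'c) bicat \<Rightarrow> 'm \<Rightarrow> 'o \<Rightarrow> 'o \<Rightarrow> bool" where
  "arrow B f x y \<longleftrightarrow> f \<in> Arr B \<and> src B f = x \<and> tgt B f = y"

definition cell :: "('o, 'm, 'c) bicat \<Rightarrow> 'c \<Rightarrow> 'm \<Rightarrow> 'm \<Rightarrow> bool" where
  "cell B \<alpha> f g \<longleftrightarrow> \<alpha> \<in> Cell B \<and> csrc B \<alpha> = f \<and> ctgt B \<alpha> = g"

definition iso_cell :: "('o, 'm, 'c) bicat \<Rightarrow> 'c \<Rightarrow> 'm \<Rightarrow> 'm \<Rightarrow> bool" where
  "iso_cell B \<alpha> f g \<longleftrightarrow> cell B \<alpha> f g \<and>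
     (\<exists>\<beta>. cell B \<beta> g f \<and> \<beta> \<cdot>\<^bsub>B\<^esub> \<alpha> = idcell B f \<and> \<alpha> \<cdot>\<^bsub>B\<^esub> \<beta> = idcell B g)"

locale bicategory =
  fixes B :: "('o, 'm, 'c) bicat" (structure)
  assumes arr_ends: "f \<in> Arr B \<Longrightarrow> src B f \<in> Obj B \<and> tgt B f \<in> Obj B"
    and cell_ends: "\<alpha> \<in> Cell B \<Longrightarrow> csrc B \<alpha> \<in> Arr B \<and> ctgt B \<alpha> \<in> Arr B \<and>
          src B (csrc B \<alpha>) = src B (ctgt B \<alpha>) \<and> tgt B (csrc B \<alpha>) = tgt B (ctgt B \<alpha>)"
    \<comment> \<open>the hom-categories\<close>
    and idcell: "f \<in> Arr B \<Longrightarrow> cell B (idcell B f) f f"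
    and vcomp: "cell B \<alpha> f g \<Longrightarrow> cell B \<beta> g h \<Longrightarrow> cell B (\<beta> \<cdot> \<alpha>) f h"
    and vcomp_assoc: "cell B \<alpha> f g \<Longrightarrow> cell B \<beta> g h \<Longrightarrow> cell B \<gamma> h k \<Longrightarrow>
          (\<gamma> \<cdot> \<beta>) \<cdot> \<alpha> = \<gamma> \<cdot> (\<beta> \<cdot> \<alpha>)"
    and vcomp_idl: "cell B \<alpha> f g \<Longrightarrow> idcell B g \<cdot> \<alpha> = \<alpha>"
    and vcomp_idr: "cell B \<alpha> f g \<Longrightarrow> \<alpha> \<cdot> idcell B f = \<alpha>"
    \<comment> \<open>identity arrows and the composition functors\<close>
    and idarr: "x \<in> Obj B \<Longrightarrow> arrow B (idarr B x) x x"
    and comp: "arrow B f x y \<Longrightarrow> arrow B g y z \<Longrightarrow> arrow B (g \<odot> f) x z"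
    and hcomp: "cell B \<alpha> f f' \<Longrightarrow> cell B \<beta> g g' \<Longrightarrow> tgt B f = src B g \<Longrightarrow>
          cell B (\<beta> \<star> \<alpha>) (g \<odot> f) (g' \<odot> f')"
    and hcomp_id: "arrow B f x y \<Longrightarrow> arrow B g y z \<Longrightarrow>
          idcell B g \<star> idcell B f = idcell B (g \<odot> f)"
    and interchange: "cell B \<alpha> f f' \<Longrightarrow> cell B \<alpha>' f' f'' \<Longrightarrow> cell B \<beta> g g' \<Longrightarrow> cell B \<beta>' g' g'' \<Longrightarrow>
          tgt B f = src B g \<Longrightarrow> (\<beta>' \<cdot> \<beta>) \<star> (\<alpha>' \<cdot> \<alpha>) = (\<beta>' \<star> \<alpha>') \<cdot> (\<beta> \<star> \<alpha>)"
    \<comment> \<open>constraints: invertible, natural, coherent\<close>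
    and assoc: "arrow B f w x \<Longrightarrow> arrow B g x y \<Longrightarrow> arrow B h y z \<Longrightarrow>
          iso_cell B (assoc B h g f) ((h \<odot> g) \<odot> f) (h \<odot> (g \<odot> f))"
    and lunit: "arrow B f x y \<Longrightarrow> iso_cell B (lunit B f) (idarr B y \<odot> f) f"
    and runit: "arrow B f x y \<Longrightarrow> iso_cell B (runit B f) (f \<odot> idarr B x) f"
    and assoc_natural: "cell B \<alpha> f f' \<Longrightarrow> cell B \<beta> g g' \<Longrightarrow> cell B \<gamma> h h' \<Longrightarrow>
          tgt B f = src B g \<Longrightarrow> tgt B g = src B h \<Longrightarrow>
          assoc B h' g' f' \<cdot> ((\<gamma> \<star> \<beta>) \<star> \<alpha>) = (\<gamma> \<star> (\<beta> \<star> \<alpha>)) \<cdot> assoc B h g f"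
    and lunit_natural: "cell B \<alpha> f g \<Longrightarrow>
          lunit B g \<cdot> (idcell B (idarr B (tgt B f)) \<star> \<alpha>) = \<alpha> \<cdot> lunit B f"
    and runit_natural: "cell B \<alpha> f g \<Longrightarrow>
          runit B g \<cdot> (\<alpha> \<star> idcell B (idarr B (src B f))) = \<alpha> \<cdot> runit B f"
    and pentagon: "arrow B f v w \<Longrightarrow> arrow B g w x \<Longrightarrow> arrow B h x y \<Longrightarrow> arrow B k y z \<Longrightarrow>
          assoc B k h (g \<odot> f) \<cdot> assoc B (k \<odot> h) g f =
          (idcell B k \<star> assoc B h g f) \<cdot> assoc B k (h \<odot> g) f \<cdot> (assoc B k h g \<star> idcell B f)"
    and triangle: "arrow B f x y \<Longrightarrow> arrow B g y z \<Longrightarrow>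
          (idcell B g \<star> lunit B f) \<cdot> assoc B g (idarr B y) f = runit B g \<star> idcell B f"

text \<open>\<open>\<alpha> : h \<odot> f \<Rightarrow> g\<close> exhibits \<open>f : a \<rightarrow> b\<close> as a right lifting of \<open>g : a \<rightarrow> c\<close> through \<open>h : b \<rightarrow> c\<close>.\<close>

definition right_lifting :: "('o, 'm, 'c) bicat \<Rightarrow> 'm \<Rightarrow> 'm \<Rightarrow> 'm \<Rightarrow> 'c \<Rightarrow> bool" where
  "right_lifting B f g h \<alpha> \<longleftrightarrow> (\<exists>a b c.
     arrow B f a b \<and> arrow B h b c \<and> arrow B g a c \<and> cell B \<alpha> (h \<odot>\<^bsub>B\<^esub> f) g \<and>
     (\<forall>k \<beta>. arrow B k a b \<and> cell B \<beta> (h \<odot>\<^bsub>B\<^esub> k) g \<longrightarrow>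
        (\<exists>!\<beta>'. cell B \<beta>' k f \<and> \<beta> = \<alpha> \<cdot>\<^bsub>B\<^esub> (idcell B h \<star>\<^bsub>B\<^esub> \<beta>'))))"


section \<open>Duplicial structure on a simplicial set\<close>

text \<open>\<open>face X n i : X\<^sub>n \<rightarrow> X\<^sub>n\<^sub>-\<^sub>1\<close> and \<open>degen X n i : X\<^sub>n \<rightarrow> X\<^sub>n\<^sub>+\<^sub>1\<close>.\<close>

record 'a sset =
  simplices :: "nat \<Rightarrow> 'a set"
  face      :: "nat \<Rightarrow> nat \<Rightarrow> 'a \<Rightarrow> 'a"
  degen     :: "nat \<Rightarrow> nat \<Rightarrow> 'a \<Rightarrow> 'a"

text \<open>
  The maps \<open>t\<^sub>n\<close> are extensional (\<open>\<rightarrow>\<^sub>E\<close>), so that equality of duplicial structures is agreement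
  on all simplices.
\<close>

definition duplicial_structure :: "'a sset \<Rightarrow> (nat \<Rightarrow> 'a \<Rightarrow> 'a) \<Rightarrow> bool" where
  "duplicial_structure X t \<longleftrightarrow>
     (\<forall>n. t n \<in> simplices X n \<rightarrow>\<^sub>E simplices X n) \<and>
     (\<forall>n. \<forall>\<sigma>\<in>simplices X (n + 1).
        (\<forall>i\<in>{1..n + 1}. face X (n + 1) i (t (n + 1) \<sigma>) = t n (face X (n + 1) (i - 1) \<sigma>)) \<and>
        face X (n + 1) 0 (t (n + 1) \<sigma>) = face X (n + 1) (n + 1) \<sigma>) \<and>
     (\<forall>n. \<forall>\<sigma>\<in>simplices X n.
        (\<forall>i\<in>{1..n}. degen X n i (t n \<sigma>) = t (n + 1) (degen X n (i - 1) \<sigma>)) \<and>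
        degen X n 0 (t n \<sigma>) = t (n + 1) (t (n + 1) (degen X n n \<sigma>)))"


section \<open>The nerve of a bicategory\<close>

text \<open>
  \<open>S2 f g h \<alpha>\<close> is \<open>\<alpha> : g \<odot> f \<Rightarrow> h\<close>. In \<open>S3 f g h k l m \<alpha> \<beta> \<gamma> \<delta>\<close> the edges are
  \<open>f : x \<rightarrow> y\<close>, \<open>g : y \<rightarrow> z\<close>, \<open>h : z \<rightarrow> w\<close>, \<open>k : x \<rightarrow> z\<close>, \<open>l : y \<rightarrow> w\<close>, \<open>m : x \<rightarrow> w\<close>.
  Above dimension 3 coskeletality says that \<open>(d\<^sub>0, \<dots>, d\<^sub>n)\<close> identifies the \<open>n\<close>-simplices with the
  lists of \<open>n + 1\<close> matching \<open>(n - 1)\<close>-simplices; \<open>SN\<close> wraps such a list.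
\<close>

datatype ('o, 'm, 'c) simplex =
    S0 (ob_of: 'o)
  | S1 (arr_of: 'm)
  | S2 'm 'm 'm (cell_of: 'c)
  | S3 'm 'm 'm 'm 'm 'm 'c 'c 'c 'c
  | SN "('o, 'm, 'c) simplex list"

fun nerve_face :: "('o, 'm, 'c) bicat \<Rightarrow> nat \<Rightarrow> ('o, 'm, 'c) simplex \<Rightarrow> ('o, 'm, 'c) simplex" where
  "nerve_face B i (S0 x) = undefined"
| "nerve_face B i (S1 f) = S0 (if i = 0 then tgt B f else src B f)"
| "nerve_face B i (S2 f g h \<alpha>) = S1 (if i = 0 then g else if i = 1 then h else f)"
| "nerve_face B i (S3 f g h k l m \<alpha> \<beta> \<gamma> \<delta>) =
     (if i = 0 then S2 g h l \<alpha> else if i = 1 then S2 k h m \<gamma>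
      else if i = 2 then S2 f l m \<delta> else S2 f g k \<beta>)"
| "nerve_face B i (SN \<sigma>s) = \<sigma>s ! i"

fun nerve_simplices :: "('o, 'm, 'c) bicat \<Rightarrow> nat \<Rightarrow> ('o, 'm, 'c) simplex set" where
  "nerve_simplices B 0 = S0 ` Obj B"
| "nerve_simplices B (Suc 0) = S1 ` Arr B"
| "nerve_simplices B (Suc (Suc 0)) =
     {S2 f g h \<alpha> | f g h \<alpha>. \<exists>x y z.
        arrow B f x y \<and> arrow B g y z \<and> arrow B h x z \<and> cell B \<alpha> (g \<odot>\<^bsub>B\<^esub> f) h}"
| "nerve_simplices B (Suc (Suc (Suc 0))) =
     {S3 f g h k l m \<alpha> \<beta> \<gamma> \<delta> | f g h k l m \<alpha> \<beta> \<gamma> \<delta>. \<exists>x y z w.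
        arrow B f x y \<and> arrow B g y z \<and> arrow B h z w \<and>
        arrow B k x z \<and> arrow B l y w \<and> arrow B m x w \<and>
        cell B \<alpha> (h \<odot>\<^bsub>B\<^esub> g) l \<and> cell B \<beta> (g \<odot>\<^bsub>B\<^esub> f) k \<and>
        cell B \<gamma> (h \<odot>\<^bsub>B\<^esub> k) m \<and> cell B \<delta> (l \<odot>\<^bsub>B\<^esub> f) m \<and>
        \<delta> \<cdot>\<^bsub>B\<^esub> (\<alpha> \<star>\<^bsub>B\<^esub> idcell B f) =
          \<gamma> \<cdot>\<^bsub>B\<^esub> (idcell B h \<star>\<^bsub>B\<^esub> \<beta>) \<cdot>\<^bsub>B\<^esub> assoc B h g f}"
| "nerve_simplices B (Suc (Suc (Suc (Suc n)))) =
     {SN \<sigma>s | \<sigma>s. length \<sigma>s = n + 5 \<and> set \<sigma>s \<subseteq> nerve_simplices B (Suc (Suc (Suc n))) \<and>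
        (\<forall>j<n + 5. \<forall>i<j. nerve_face B i (\<sigma>s ! j) = nerve_face B (j - 1) (\<sigma>s ! i))}"

text \<open>
  \<open>nerve_degen B n i\<close> acts on \<open>n\<close>-simplices. From dimension 3 on, it lists the faces which the
  simplicial identities prescribe for a degenerate simplex.
\<close>

fun nerve_degen :: "('o, 'm, 'c) bicat \<Rightarrow> nat \<Rightarrow> nat \<Rightarrow>
    ('o, 'm, 'c) simplex \<Rightarrow> ('o, 'm, 'c) simplex" where
  "nerve_degen B 0 i \<sigma> = (case \<sigma> of S0 x \<Rightarrow> S1 (idarr B x) | _ \<Rightarrow> undefined)"
| "nerve_degen B (Suc 0) i \<sigma> = (case \<sigma> of S1 f \<Rightarrow>
       if i = 0 then S2 (idarr B (src B f)) f f (runit B f)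
       else S2 f (idarr B (tgt B f)) f (lunit B f)
     | _ \<Rightarrow> undefined)"
| "nerve_degen B (Suc (Suc 0)) i \<sigma> = (case \<sigma> of S2 f g h \<alpha> \<Rightarrow>
       if i = 0 then S3 (idarr B (src B f)) f g f h h \<alpha> (runit B f) \<alpha> (runit B h)
       else if i = 1 then S3 f (idarr B (tgt B f)) g f g h (runit B g) (lunit B f) \<alpha> \<alpha>
       else S3 f g (idarr B (tgt B g)) h g h (lunit B g) \<alpha> (lunit B h) \<alpha>
     | _ \<Rightarrow> undefined)"
| "nerve_degen B (Suc (Suc (Suc n))) i \<sigma> = SN (map (\<lambda>j.
       if j < i then nerve_degen B (Suc (Suc n)) (i - 1) (nerve_face B j \<sigma>)
       else if j \<le> i + 1 then \<sigma>
       else nerve_degen B (Suc (Suc n)) i (nerve_face B (j - 1) \<sigma>)) [0..<n + 5])"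

definition nerve :: "('o, 'm, 'c) bicat \<Rightarrow> ('o, 'm, 'c) simplex sset" where
  "nerve B = \<lparr>simplices = nerve_simplices B, face = (\<lambda>_. nerve_face B), degen = nerve_degen B\<rparr>"


section \<open>Chosen right liftings\<close>

text \<open>
  \<open>t_ob D x\<close>, \<open>eps_ob D x\<close>, \<open>t_arr D f\<close>, \<open>eps_arr D f\<close> are \<open>tx\<close>, \<open>\<epsilon>\<^sub>x\<close>, \<open>tf\<close>, \<open>\<epsilon>\<^sub>f\<close>; again they are
  extensional.
\<close>

record ('o, 'm, 'c) lifting_data =
  t_ob    :: "'o \<Rightarrow> 'o"
  eps_ob  :: "'o \<Rightarrow> 'm"
  t_arr   :: "'m \<Rightarrow> 'm"
  eps_arr :: "'m \<Rightarrow> 'c"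

definition lifting_structure :: "('o, 'm, 'c) bicat \<Rightarrow> ('o, 'm, 'c) lifting_data \<Rightarrow> bool" where
  "lifting_structure B D \<longleftrightarrow>
     t_ob D \<in> extensional (Obj B) \<and> eps_ob D \<in> extensional (Obj B) \<and>
     t_arr D \<in> extensional (Arr B) \<and> eps_arr D \<in> extensional (Arr B) \<and>
     (\<forall>x\<in>Obj B. t_ob D x \<in> Obj B \<and> arrow B (eps_ob D x) (t_ob D x) x) \<and>
     (\<forall>f a x. arrow B f a x \<longrightarrow>
        arrow B (t_arr D f) (t_ob D x) a \<and>
        cell B (eps_arr D f) (f \<odot>\<^bsub>B\<^esub> t_arr D f) (eps_ob D x) \<and>
        right_lifting B (t_arr D f) (eps_ob D x) f (eps_arr D f)) \<and>
     (\<forall>x\<in>Obj B.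
        t_arr D (idarr B x) = eps_ob D x \<and>
        t_arr D (t_arr D (idarr B x)) = idarr B (t_ob D x) \<and>
        eps_arr D (t_arr D (idarr B x)) = runit B (t_arr D (idarr B x)))"

text \<open>
  A lifting structure is normal if its right lifting \<open>t1\<^sub>x = \<epsilon>\<^sub>x\<close> of \<open>\<epsilon>\<^sub>x\<close> through \<open>1\<^sub>x\<close> is the
  canonical one, exhibited by the left unit constraint. This is not automatic: \<open>\<epsilon>\<close> at \<open>1\<^sub>x\<close> may
  be \<open>lunit\<close> followed by any automorphism of \<open>\<epsilon>\<^sub>x\<close>, unless \<open>1\<^sub>x\<close> is itself of the form \<open>t1\<^sub>y\<close>.
  On the nerve, however, \<open>s\<^sub>0s\<^sub>0 = s\<^sub>1s\<^sub>0\<close> and \<open>t\<^sub>2s\<^sub>0 = s\<^sub>1t\<^sub>1\<close> force normality.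
  \<open>normalise\<close> changes only these 2-cells.
\<close>

definition normal :: "('o, 'm, 'c) bicat \<Rightarrow> ('o, 'm, 'c) lifting_data \<Rightarrow> bool" where
  "normal B D \<longleftrightarrow> (\<forall>x\<in>Obj B. eps_arr D (idarr B x) = lunit B (eps_ob D x))"

definition normalise ::
    "('o, 'm, 'c) bicat \<Rightarrow> ('o, 'm, 'c) lifting_data \<Rightarrow> ('o, 'm, 'c) lifting_data" where
  "normalise B D = D\<lparr>eps_arr := (\<lambda>f.
     if f \<in> idarr B ` Obj B then lunit B (eps_ob D (tgt B f)) else eps_arr D f)\<rparr>"

text \<open>
  The lifting data read off from a duplicial structure on the nerve: \<open>\<epsilon>\<^sub>x = t\<^sub>1 s\<^sub>0 x\<close>, and \<open>\<epsilon>\<^sub>f\<close> is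
  the 2-cell of \<open>t\<^sub>2 s\<^sub>1 f\<close>, whose faces are \<open>d\<^sub>0 = f\<close>, \<open>d\<^sub>1 = t\<^sub>1 s\<^sub>0 x\<close>, \<open>d\<^sub>2 = t\<^sub>1 f\<close> for \<open>f : a \<rightarrow> x\<close>.
\<close>

definition underlying_liftings :: "('o, 'm, 'c) bicat \<Rightarrow>
    (nat \<Rightarrow> ('o, 'm, 'c) simplex \<Rightarrow> ('o, 'm, 'c) simplex) \<Rightarrow> ('o, 'm, 'c) lifting_data" where
  "underlying_liftings B t =
     \<lparr>t_ob = (\<lambda>x\<in>Obj B. ob_of (t 0 (S0 x))),
      eps_ob = (\<lambda>x\<in>Obj B. arr_of (t 1 (degen (nerve B) 0 0 (S0 x)))),
      t_arr = (\<lambda>f\<in>Arr B. arr_of (t 1 (S1 f))),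
      eps_arr = (\<lambda>f\<in>Arr B. cell_of (t 2 (degen (nerve B) 1 1 (S1 f))))\<rparr>"

end

theory Submission
  imports Defs
begin

text \<open>
  Write \<open>t f : t x \<rightarrow> a\<close> for the rotation of an arrow \<open>f : a \<rightarrow> x\<close>. A duplicial operator sends a
  2-simplex \<open>\<alpha> : g \<odot> f \<Rightarrow> h\<close> to a 2-cell \<open>\<tau> : f \<odot> t h \<Rightarrow> t g\<close>, its mate, and the image of a
  3-simplex exists exactly if the mates of its faces satisfy a pasting equation. For the
  degenerate 3-simplex \<open>s\<^sub>2 \<alpha>\<close>, whose last edge is an identity, this equation reads
  \<open>\<epsilon>\<^sub>g \<cdot> (g \<star> \<tau>) \<cdot> assoc = \<epsilon>\<^sub>h \<cdot> (\<alpha> \<star> t h)\<close>: the mate of \<open>\<alpha>\<close> is the factorisation through \<open>\<epsilon>\<^sub>g\<close> of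
  a 2-cell built from \<open>\<alpha>\<close> and \<open>\<epsilon>\<^sub>h\<close>.

  Given chosen right liftings, this equation has exactly one solution (\<open>mate_ex1\<close>), which
  defines \<open>t\<close> on 2-simplices. The universal property of \<open>\<epsilon>\<close> and the pentagon then give the pasting
  equation for all 3-simplices (\<open>mate_pasting\<close>), and in higher dimensions coskeletality
  leaves no choice and no condition. Compatibility with degeneracies has to be checked only in
  dimensions 0 and 1, because from dimension 3 on simplices are determined by their faces
  (\<open>duplicial_degens_from_low\<close>); in dimension 1 this determines the mates of \<open>runit\<close>, \<open>lunit\<close> and \<open>\<epsilon>\<^sub>f\<close>,
  by the triangle identity, normality, and the condition \<open>\<epsilon> = runit\<close> at \<open>t 1\<^sub>x\<close> respectively.

  Conversely, given a duplicial operator, a factorisation of \<open>\<beta> : f \<odot> k \<Rightarrow> \<epsilon>\<^sub>x\<close> through \<open>\<epsilon>\<^sub>f\<close> is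
  provided by the mate of \<open>\<beta>\<close> itself, a 2-cell \<open>k \<odot> 1 \<Rightarrow> t f\<close>. It is the only one, because \<open>t\<close>
  applied twice to \<open>s\<^sub>1 f\<close> gives back \<open>s\<^sub>0 (t f)\<close>, so that the mate of \<open>\<epsilon>\<^sub>f\<close> is a unit constraint and
  pasting recovers any factorisation from the mate of \<open>\<beta>\<close> (\<open>t_cell_through_eps_iff\<close>).
\<close>

section \<open>Calculating with 2-cells\<close>

context bicategory
begin

text \<open>
  The axioms are restated with composability conditions on sources and targets in place of named
  boundaries. These conditions contain no variables beyond those of the equation, so that the
  simplifier can check them and normalise vertical composites to right-nested form.
\<close>

lemma src_Obj [simp]: "f \<in> Arr B \<Longrightarrow> src B f \<in> Obj B"
  and tgt_Obj [simp]: "f \<in> Arr B \<Longrightarrow> tgt B f \<in> Obj B"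
  using arr_ends by auto

lemma csrc_Arr [simp]: "\<alpha> \<in> Cell B \<Longrightarrow> csrc B \<alpha> \<in> Arr B"
  and ctgt_Arr [simp]: "\<alpha> \<in> Cell B \<Longrightarrow> ctgt B \<alpha> \<in> Arr B"
  and src_ctgt: "\<alpha> \<in> Cell B \<Longrightarrow> src B (ctgt B \<alpha>) = src B (csrc B \<alpha>)"
  and tgt_ctgt: "\<alpha> \<in> Cell B \<Longrightarrow> tgt B (ctgt B \<alpha>) = tgt B (csrc B \<alpha>)"
  using cell_ends by auto

lemma idcell_simps [simp]:
  assumes "f \<in> Arr B"
  shows "idcell B f \<in> Cell B" "csrc B (idcell B f) = f" "ctgt B (idcell B f) = f"
  using idcell[OF assms] by (auto simp: cell_def)

lemma idarr_simps [simp]: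
  assumes "x \<in> Obj B"
  shows "idarr B x \<in> Arr B" "src B (idarr B x) = x" "tgt B (idarr B x) = x"
  using idarr[OF assms] by (auto simp: arrow_def)

lemma comp_simps [simp]:
  assumes "f \<in> Arr B" "g \<in> Arr B" "tgt B f = src B g"
  shows "g \<odot> f \<in> Arr B" "src B (g \<odot> f) = src B f" "tgt B (g \<odot> f) = tgt B g"
  using comp[of f "src B f" "tgt B f" g "tgt B g"] assms by (auto simp: arrow_def)

lemma vcomp_simps [simp]:
  assumes "\<alpha> \<in> Cell B" "\<beta> \<in> Cell B" "ctgt B \<alpha> = csrc B \<beta>"
  shows "\<beta> \<cdot> \<alpha> \<in> Cell B" "csrc B (\<beta> \<cdot> \<alpha>) = csrc B \<alpha>" "ctgt B (\<beta> \<cdot> \<alpha>) = ctgt B \<beta>"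
  using vcomp[of \<alpha> "csrc B \<alpha>" "ctgt B \<alpha>" \<beta> "ctgt B \<beta>"] assms by (auto simp: cell_def)

lemma hcomp_simps [simp]:
  assumes "\<alpha> \<in> Cell B" "\<beta> \<in> Cell B" "tgt B (csrc B \<alpha>) = src B (csrc B \<beta>)"
  shows "\<beta> \<star> \<alpha> \<in> Cell B" "csrc B (\<beta> \<star> \<alpha>) = csrc B \<beta> \<odot> csrc B \<alpha>"
    "ctgt B (\<beta> \<star> \<alpha>) = ctgt B \<beta> \<odot> ctgt B \<alpha>"
  using hcomp[of \<alpha> "csrc B \<alpha>" "ctgt B \<alpha>" \<beta> "csrc B \<beta>" "ctgt B \<beta>"] assms by (auto simp: cell_def)

lemma assoc_simps [simp]:
  assumes "f \<in> Arr B" "g \<in> Arr B" "h \<in> Arr B" "tgt B f = src B g" "tgt B g = src B h"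
  shows "assoc B h g f \<in> Cell B" "csrc B (assoc B h g f) = (h \<odot> g) \<odot> f"
    "ctgt B (assoc B h g f) = h \<odot> (g \<odot> f)"
  using assoc[of f "src B f" "tgt B f" g "tgt B g" h "tgt B h"] assms
  by (auto simp: arrow_def iso_cell_def cell_def)

lemma lunit_simps [simp]:
  assumes "f \<in> Arr B"
  shows "lunit B f \<in> Cell B" "csrc B (lunit B f) = idarr B (tgt B f) \<odot> f"
    "ctgt B (lunit B f) = f"
  using lunit[of f "src B f" "tgt B f"] assms by (auto simp: arrow_def iso_cell_def cell_def)

lemma runit_simps [simp]:
  assumes "f \<in> Arr B"
  shows "runit B f \<in> Cell B" "csrc B (runit B f) = f \<odot> idarr B (src B f)"
    "ctgt B (runit B f) = f"
  using runit[of f "src B f" "tgt B f"] assms by (auto simp: arrow_def iso_cell_def cell_def)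

lemma vcomp_assoc' [simp]:
  assumes "\<alpha> \<in> Cell B" "\<beta> \<in> Cell B" "\<gamma> \<in> Cell B"
    "ctgt B \<alpha> = csrc B \<beta>" "ctgt B \<beta> = csrc B \<gamma>"
  shows "(\<gamma> \<cdot> \<beta>) \<cdot> \<alpha> = \<gamma> \<cdot> (\<beta> \<cdot> \<alpha>)"
  using vcomp_assoc[of \<alpha> "csrc B \<alpha>" "ctgt B \<alpha>" \<beta> "ctgt B \<beta>" \<gamma> "ctgt B \<gamma>"] assms
  by (auto simp: cell_def)

lemma vcomp_id [simp]:
  "\<alpha> \<in> Cell B \<Longrightarrow> ctgt B \<alpha> = g \<Longrightarrow> idcell B g \<cdot> \<alpha> = \<alpha>"
  "\<alpha> \<in> Cell B \<Longrightarrow> csrc B \<alpha> = f \<Longrightarrow> \<alpha> \<cdot> idcell B f = \<alpha>"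
  using vcomp_idl[of \<alpha>] vcomp_idr[of \<alpha>] by (auto simp: cell_def)

lemma hcomp_idcell [simp]:
  assumes "f \<in> Arr B" "g \<in> Arr B" "tgt B f = src B g"
  shows "idcell B g \<star> idcell B f = idcell B (g \<odot> f)"
  using hcomp_id[of f "src B f" "tgt B f" g "tgt B g"] assms by (auto simp: arrow_def)

lemma interchange':
  assumes "\<alpha> \<in> Cell B" "\<alpha>' \<in> Cell B" "\<beta> \<in> Cell B" "\<beta>' \<in> Cell B"
    "ctgt B \<alpha> = csrc B \<alpha>'" "ctgt B \<beta> = csrc B \<beta>'" "tgt B (csrc B \<alpha>) = src B (csrc B \<beta>)"
  shows "(\<beta>' \<star> \<alpha>') \<cdot> (\<beta> \<star> \<alpha>) = (\<beta>' \<cdot> \<beta>) \<star> (\<alpha>' \<cdot> \<alpha>)"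
  using interchange[of \<alpha> "csrc B \<alpha>" "ctgt B \<alpha>" \<alpha>' "ctgt B \<alpha>'" \<beta> "csrc B \<beta>" "ctgt B \<beta>" \<beta>' "ctgt B \<beta>'"] assms
  by (auto simp: cell_def)

lemma whisker_vcomp:
  assumes "\<alpha> \<in> Cell B" "\<beta> \<in> Cell B" "ctgt B \<alpha> = csrc B \<beta>" "f \<in> Arr B"
  shows "tgt B (csrc B \<alpha>) = src B f \<Longrightarrow>
      idcell B f \<star> (\<beta> \<cdot> \<alpha>) = (idcell B f \<star> \<beta>) \<cdot> (idcell B f \<star> \<alpha>)"
    and "tgt B f = src B (csrc B \<alpha>) \<Longrightarrow>
      (\<beta> \<cdot> \<alpha>) \<star> idcell B f = (\<beta> \<star> idcell B f) \<cdot> (\<alpha> \<star> idcell B f)"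
  using assms by (simp_all add: interchange')

lemma whisker_exchange:
  assumes "\<alpha> \<in> Cell B" "\<beta> \<in> Cell B" "tgt B (csrc B \<alpha>) = src B (csrc B \<beta>)"
    "csrc B \<alpha> = f" "ctgt B \<alpha> = f'" "csrc B \<beta> = g" "ctgt B \<beta> = g'"
  shows "(idcell B g' \<star> \<alpha>) \<cdot> (\<beta> \<star> idcell B f) = (\<beta> \<star> idcell B f') \<cdot> (idcell B g \<star> \<alpha>)"
proof -
  have "f \<in> Arr B" "f' \<in> Arr B" "g \<in> Arr B" "g' \<in> Arr B"
    using assms csrc_Arr ctgt_Arr by blast+
  then show ?thesis
    using assms src_ctgt[of \<beta>] tgt_ctgt[of \<alpha>] by (simp add: interchange')
qed

lemma assoc_natural':
  assumes "\<alpha> \<in> Cell B" "\<beta> \<in> Cell B" "\<gamma> \<in> Cell B"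
    "tgt B (csrc B \<alpha>) = src B (csrc B \<beta>)" "tgt B (csrc B \<beta>) = src B (csrc B \<gamma>)"
  shows "assoc B (ctgt B \<gamma>) (ctgt B \<beta>) (ctgt B \<alpha>) \<cdot> ((\<gamma> \<star> \<beta>) \<star> \<alpha>) =
    (\<gamma> \<star> (\<beta> \<star> \<alpha>)) \<cdot> assoc B (csrc B \<gamma>) (csrc B \<beta>) (csrc B \<alpha>)"
  using assms assoc_natural[of \<alpha> "csrc B \<alpha>" _ \<beta> "csrc B \<beta>" _ \<gamma> "csrc B \<gamma>"]
  by (auto simp: cell_def)

lemma lunit_natural':
  assumes "\<alpha> \<in> Cell B" "csrc B \<alpha> = f" "ctgt B \<alpha> = g" "x = tgt B f"
  shows "lunit B g \<cdot> (idcell B (idarr B x) \<star> \<alpha>) = \<alpha> \<cdot> lunit B f"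
  using assms lunit_natural[of \<alpha> f g] by (auto simp: cell_def)

lemma runit_natural':
  assumes "\<alpha> \<in> Cell B" "csrc B \<alpha> = f" "ctgt B \<alpha> = g" "x = src B f"
  shows "runit B g \<cdot> (\<alpha> \<star> idcell B (idarr B x)) = \<alpha> \<cdot> runit B f"
  using assms runit_natural[of \<alpha> f g] by (auto simp: cell_def)

lemma pentagon':
  assumes "f \<in> Arr B" "g \<in> Arr B" "h \<in> Arr B" "k \<in> Arr B"
    "tgt B f = src B g" "tgt B g = src B h" "tgt B h = src B k"
  shows "assoc B k h (g \<odot> f) \<cdot> assoc B (k \<odot> h) g f =
    (idcell B k \<star> assoc B h g f) \<cdot> assoc B k (h \<odot> g) f \<cdot> (assoc B k h g \<star> idcell B f)"
  using assms pentagon[of f "src B f" "src B g" g "src B h" h "src B k" k "tgt B k"]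
  by (auto simp: arrow_def)

lemma triangle':
  assumes "f \<in> Arr B" "g \<in> Arr B" "tgt B f = y" "src B g = y"
  shows "(idcell B g \<star> lunit B f) \<cdot> assoc B g (idarr B y) f = runit B g \<star> idcell B f"
  using assms triangle[of f "src B f" y g "tgt B g"] by (auto simp: arrow_def)

text \<open>
  In a right-nested composite, an equation between composites of two factors matches no subterm
  unless it concerns the last two factors.
\<close>

lemma vcomp_cong_head:
  assumes "\<alpha> \<cdot> \<beta> = \<gamma>" "\<tau> \<in> Cell B" "\<beta> \<in> Cell B" "\<alpha> \<in> Cell B"
    "ctgt B \<tau> = csrc B \<beta>" "ctgt B \<beta> = csrc B \<alpha>"
  shows "\<alpha> \<cdot> (\<beta> \<cdot> \<tau>) = \<gamma> \<cdot> \<tau>"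
  using assms by (simp flip: assms(1))

lemma assoc_iso':
  assumes "f \<in> Arr B" "g \<in> Arr B" "h \<in> Arr B" "tgt B f = src B g" "tgt B g = src B h"
  shows "iso_cell B (assoc B h g f) ((h \<odot> g) \<odot> f) (h \<odot> (g \<odot> f))"
  using assoc[of f "src B f" "tgt B f" g "tgt B g" h "tgt B h"] assms by (auto simp: arrow_def)

lemma lunit_iso': "f \<in> Arr B \<Longrightarrow> iso_cell B (lunit B f) (idarr B (tgt B f) \<odot> f) f"
  and runit_iso': "f \<in> Arr B \<Longrightarrow> iso_cell B (runit B f) (f \<odot> idarr B (src B f)) f"
  using lunit[of f "src B f" "tgt B f"] runit[of f "src B f" "tgt B f"] by (auto simp: arrow_def)

lemma iso_cancel_left:
  assumes "iso_cell B \<theta> f g" "cell B \<alpha> e f" "cell B \<beta> e f" "\<theta> \<cdot> \<alpha> = \<theta> \<cdot> \<beta>"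
  shows "\<alpha> = \<beta>"
proof -
  obtain \<theta>' where \<theta>': "cell B \<theta>' g f" "\<theta>' \<cdot> \<theta> = idcell B f"
    using assms(1) by (auto simp: iso_cell_def)
  have "(\<theta>' \<cdot> \<theta>) \<cdot> \<alpha> = (\<theta>' \<cdot> \<theta>) \<cdot> \<beta>"
    using assms \<theta>'(1) by (simp add: cell_def iso_cell_def)
  then show ?thesis using assms(2,3) \<theta>'(2) by (simp add: cell_def)
qed

lemma iso_cancel_right:
  assumes "iso_cell B \<theta> f g" "cell B \<alpha> g h" "cell B \<beta> g h" "\<alpha> \<cdot> \<theta> = \<beta> \<cdot> \<theta>"
  shows "\<alpha> = \<beta>"
proof -
  obtain \<theta>' where \<theta>': "cell B \<theta>' g f" "\<theta> \<cdot> \<theta>' = idcell B g" and \<theta>: "cell B \<theta> f g"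
    using assms(1) by (auto simp: iso_cell_def)
  have "\<alpha> \<cdot> (\<theta> \<cdot> \<theta>') = \<beta> \<cdot> (\<theta> \<cdot> \<theta>')"
    using vcomp_cong_head[OF assms(4), of \<theta>'] assms(2,3) \<theta>'(1) \<theta> by (simp add: cell_def)
  then show ?thesis using assms(2,3) \<theta>'(2) by (simp add: cell_def)
qed

lemma iso_whisker_right:
  assumes "iso_cell B \<theta> g g'" "f \<in> Arr B" "tgt B f = src B g"
  shows "iso_cell B (\<theta> \<star> idcell B f) (g \<odot> f) (g' \<odot> f)"
proof -
  obtain \<theta>' where \<theta>': "cell B \<theta>' g' g" "\<theta>' \<cdot> \<theta> = idcell B g" "\<theta> \<cdot> \<theta>' = idcell B g'"
    and \<theta>: "cell B \<theta> g g'"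
    using assms(1) by (auto simp: iso_cell_def)
  have [simp]: "g \<in> Arr B" "g' \<in> Arr B" "src B g' = src B g"
    using \<theta> src_ctgt[of \<theta>] by (auto simp: cell_def)
  have "(\<theta>' \<star> idcell B f) \<cdot> (\<theta> \<star> idcell B f) = idcell B (g \<odot> f)"
    "(\<theta> \<star> idcell B f) \<cdot> (\<theta>' \<star> idcell B f) = idcell B (g' \<odot> f)"
    using \<theta> \<theta>' assms(2,3) by (simp_all add: cell_def flip: whisker_vcomp(2))
  moreover have "cell B (\<theta> \<star> idcell B f) (g \<odot> f) (g' \<odot> f)"
    "cell B (\<theta>' \<star> idcell B f) (g' \<odot> f) (g \<odot> f)"
    using \<theta> \<theta>' assms(2,3) by (simp_all add: cell_def)
  ultimately show ?thesis by (auto simp: iso_cell_def)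
qed

text \<open>
  Naturality of \<open>lunit\<close> exhibits whiskering with an identity arrow as isomorphic to the identity
  functor.
\<close>

lemma idarr_whisker_left_faithful:
  assumes "cell B \<alpha> f g" "cell B \<beta> f g" "x = tgt B f"
    "idcell B (idarr B x) \<star> \<alpha> = idcell B (idarr B x) \<star> \<beta>"
  shows "\<alpha> = \<beta>"
proof -
  have f: "f \<in> Arr B" using assms(1) by (auto simp: cell_def)
  have "\<alpha> \<cdot> lunit B f = \<beta> \<cdot> lunit B f"
    using lunit_natural'[of \<alpha> f g x] lunit_natural'[of \<beta> f g x] assms by (simp add: cell_def)
  then show ?thesis using iso_cancel_right[OF lunit_iso'[OF f]] assms(1,2) by blast
qed

lemma idarr_whisker_right_faithful:
  assumes "cell B \<alpha> f g" "cell B \<beta> f g" "x = src B f"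
    "\<alpha> \<star> idcell B (idarr B x) = \<beta> \<star> idcell B (idarr B x)"
  shows "\<alpha> = \<beta>"
proof -
  have f: "f \<in> Arr B" using assms(1) by (auto simp: cell_def)
  have "\<alpha> \<cdot> runit B f = \<beta> \<cdot> runit B f"
    using runit_natural'[of \<alpha> f g x] runit_natural'[of \<beta> f g x] assms by (simp add: cell_def)
  then show ?thesis using iso_cancel_right[OF runit_iso'[OF f]] assms(1,2) by blast
qed

section \<open>Coherence of the unit constraints\<close>

text \<open>
  Kelly's argument: whiskering with the identity arrow is faithful, and after whiskering and
  composing with invertible associators both sides are computed by the pentagon for
  \<open>1, 1, g, f\<close> and the triangle identity.
\<close>

lemma lunit_comp:
  assumes [simp]: "f \<in> Arr B" "g \<in> Arr B" "tgt B f = src B g" and z: "z = tgt B g"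
  shows "lunit B (g \<odot> f) \<cdot> assoc B (idarr B z) g f = lunit B g \<star> idcell B f"
proof -
  let ?i = "idarr B z"
  note [simp] = z
  let ?\<theta> = "assoc B ?i ?i g \<star> idcell B f" and ?\<phi> = "assoc B ?i (?i \<odot> g) f"
  let ?L = "lunit B (g \<odot> f) \<cdot> assoc B ?i g f" and ?R = "lunit B g \<star> idcell B f"
  have "((idcell B ?i \<star> ?L) \<cdot> ?\<phi>) \<cdot> ?\<theta> =
      (idcell B ?i \<star> lunit B (g \<odot> f)) \<cdot> ((idcell B ?i \<star> assoc B ?i g f) \<cdot> ?\<phi> \<cdot> ?\<theta>)"
    by (simp add: whisker_vcomp)
  also have "\<dots> = (idcell B ?i \<star> lunit B (g \<odot> f)) \<cdot> assoc B ?i ?i (g \<odot> f) \<cdot> assoc B (?i \<odot> ?i) g f"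
    by (subst pentagon'[symmetric]) auto
  also have "\<dots> = (runit B ?i \<star> idcell B (g \<odot> f)) \<cdot> assoc B (?i \<odot> ?i) g f"
    by (rule vcomp_cong_head[OF triangle']) auto
  also have "\<dots> = assoc B ?i g f \<cdot> ((runit B ?i \<star> idcell B g) \<star> idcell B f)"
    using assoc_natural'[of "idcell B f" "idcell B g" "runit B ?i"] by simp
  also have "runit B ?i \<star> idcell B g = (idcell B ?i \<star> lunit B g) \<cdot> assoc B ?i ?i g"
    by (simp add: triangle')
  also have "assoc B ?i g f \<cdot> (((idcell B ?i \<star> lunit B g) \<cdot> assoc B ?i ?i g) \<star> idcell B f)
    = assoc B ?i g f \<cdot> ((idcell B ?i \<star> lunit B g) \<star> idcell B f) \<cdot> ?\<theta>"
    by (simp add: whisker_vcomp)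
  also have "\<dots> = ((idcell B ?i \<star> ?R) \<cdot> ?\<phi>) \<cdot> ?\<theta>"
    by (rule vcomp_cong_head)
      (use assoc_natural'[of "idcell B f" "lunit B g" "idcell B ?i"] in auto)
  finally have *: "((idcell B ?i \<star> ?L) \<cdot> ?\<phi>) \<cdot> ?\<theta> = ((idcell B ?i \<star> ?R) \<cdot> ?\<phi>) \<cdot> ?\<theta>" .
  have "(idcell B ?i \<star> ?L) \<cdot> ?\<phi> = (idcell B ?i \<star> ?R) \<cdot> ?\<phi>"
    by (rule iso_cancel_right[OF iso_whisker_right[OF assoc_iso'] _ _ *]) (auto simp: cell_def)
  then have "idcell B ?i \<star> ?L = idcell B ?i \<star> ?R"
    by (rule iso_cancel_right[OF assoc_iso', rotated -1]) (auto simp: cell_def)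
  then show ?thesis
    by (rule idarr_whisker_left_faithful[where f = "(?i \<odot> g) \<odot> f", rotated -1])
      (auto simp: cell_def)
qed

text \<open>
  The mirror image, with the pentagon for \<open>g, f, 1, 1\<close>.
\<close>

lemma runit_comp:
  assumes [simp]: "f \<in> Arr B" "g \<in> Arr B" "tgt B f = src B g" and x: "x = src B f"
  shows "(idcell B g \<star> runit B f) \<cdot> assoc B g f (idarr B x) = runit B (g \<odot> f)"
proof -
  let ?i = "idarr B x"
  note [simp] = x
  let ?L = "(idcell B g \<star> runit B f) \<cdot> assoc B g f ?i"
  have "assoc B g f ?i \<cdot> (?L \<star> idcell B ?i) =
      assoc B g f ?i \<cdot> ((idcell B g \<star> runit B f) \<star> idcell B ?i) \<cdot> (assoc B g f ?i \<star> idcell B ?i)"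
    by (simp add: whisker_vcomp)
  also have "\<dots> = ((idcell B g \<star> (runit B f \<star> idcell B ?i)) \<cdot> assoc B g (f \<odot> ?i) ?i)
      \<cdot> (assoc B g f ?i \<star> idcell B ?i)"
    by (rule vcomp_cong_head)
      (use assoc_natural'[of "idcell B ?i" "runit B f" "idcell B g"] in auto)
  also have "runit B f \<star> idcell B ?i = (idcell B f \<star> lunit B ?i) \<cdot> assoc B f ?i ?i"
    by (simp add: triangle')
  also have "((idcell B g \<star> ((idcell B f \<star> lunit B ?i) \<cdot> assoc B f ?i ?i)) \<cdot> assoc B g (f \<odot> ?i) ?i)
      \<cdot> (assoc B g f ?i \<star> idcell B ?i) = (idcell B g \<star> (idcell B f \<star> lunit B ?i)) \<cdot>
      ((idcell B g \<star> assoc B f ?i ?i) \<cdot> assoc B g (f \<odot> ?i) ?i \<cdot> (assoc B g f ?i \<star> idcell B ?i))"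
    by (simp add: whisker_vcomp)
  also have "\<dots> = (idcell B g \<star> (idcell B f \<star> lunit B ?i)) \<cdot>
      assoc B g f (?i \<odot> ?i) \<cdot> assoc B (g \<odot> f) ?i ?i"
    by (subst pentagon'[symmetric]) auto
  also have "\<dots> = (assoc B g f ?i \<cdot> (idcell B (g \<odot> f) \<star> lunit B ?i)) \<cdot> assoc B (g \<odot> f) ?i ?i"
    by (rule vcomp_cong_head)
      (use assoc_natural'[of "lunit B ?i" "idcell B f" "idcell B g"] in auto)
  also have "\<dots> = assoc B g f ?i \<cdot> (runit B (g \<odot> f) \<star> idcell B ?i)"
    by (simp add: triangle')
  finally have "?L \<star> idcell B ?i = runit B (g \<odot> f) \<star> idcell B ?i"
    by (rule iso_cancel_left[OF assoc_iso', rotated -1]) (auto simp: cell_def)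
  then show ?thesis
    by (rule idarr_whisker_right_faithful[where f = "(g \<odot> f) \<odot> ?i", rotated -1])
      (auto simp: cell_def)
qed

text \<open>
  Naturality of \<open>lunit\<close> at \<open>lunit\<close> shows that \<open>1 \<star> lunit\<close> is \<open>lunit\<close> at \<open>1 \<odot> 1\<close>. Composed with the
  associator, this 2-cell is \<open>lunit \<star> 1\<close> by \<open>lunit_comp\<close> and \<open>runit \<star> 1\<close> by the triangle identity.
\<close>

lemma lunit_idarr:
  assumes [simp]: "x \<in> Obj B"
  shows "lunit B (idarr B x) = runit B (idarr B x)"
proof -
  let ?i = "idarr B x"
  have "lunit B ?i \<cdot> (idcell B ?i \<star> lunit B ?i) = lunit B ?i \<cdot> lunit B (?i \<odot> ?i)"
    by (rule lunit_natural') auto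
  then have "idcell B ?i \<star> lunit B ?i = lunit B (?i \<odot> ?i)"
    by (rule iso_cancel_left[OF lunit_iso', rotated -1]) (auto simp: cell_def)
  then have "lunit B ?i \<star> idcell B ?i = runit B ?i \<star> idcell B ?i"
    using lunit_comp[of ?i ?i x] triangle'[of ?i ?i x] by simp
  then show ?thesis
    by (rule idarr_whisker_right_faithful[rotated -1]) (auto simp: cell_def)
qed

end

section \<open>Mates\<close>

text \<open>
  The equation for the value \<open>\<tau>\<close> of a duplicial operator on \<open>\<alpha> : g \<odot> f \<Rightarrow> h\<close>. It is a relation
  because lifting data which merely come from a duplicial operator are not known in advance to
  determine \<open>\<tau>\<close>.
\<close>

definition mate :: "('o, 'm, 'c) bicat \<Rightarrow> ('o, 'm, 'c) lifting_data \<Rightarrow> 'm \<Rightarrow> 'm \<Rightarrow> 'm \<Rightarrow> 'c \<Rightarrow> 'c \<Rightarrow> bool" where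
  "mate B D f g h \<alpha> \<tau> \<longleftrightarrow>
     cell B \<tau> (f \<odot>\<^bsub>B\<^esub> t_arr D h) (t_arr D g) \<and>
     eps_arr D g \<cdot>\<^bsub>B\<^esub> (idcell B g \<star>\<^bsub>B\<^esub> \<tau>) \<cdot>\<^bsub>B\<^esub> assoc B g f (t_arr D h) =
       eps_arr D h \<cdot>\<^bsub>B\<^esub> (\<alpha> \<star>\<^bsub>B\<^esub> idcell B (t_arr D h))"

context bicategory
begin

lemma right_lifting_ex1:
  assumes "right_lifting B f g h \<epsilon>" "arrow B h b c" "k \<in> Arr B" "src B k = src B f" "tgt B k = b"
    "cell B \<beta> (h \<odot> k) g"
  shows "\<exists>!\<kappa>. cell B \<kappa> k f \<and> \<epsilon> \<cdot> (idcell B h \<star> \<kappa>) = \<beta>"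
proof -
  have "arrow B k (src B f) b" using assms by (simp add: arrow_def)
  moreover have "\<forall>k \<beta>. arrow B k (src B f) b \<and> cell B \<beta> (h \<odot> k) g \<longrightarrow>
      (\<exists>!\<beta>'. cell B \<beta>' k f \<and> \<beta> = \<epsilon> \<cdot> (idcell B h \<star> \<beta>'))"
    using assms(1,2) by (auto simp: right_lifting_def arrow_def)
  ultimately have "\<exists>!\<kappa>. cell B \<kappa> k f \<and> \<beta> = \<epsilon> \<cdot> (idcell B h \<star> \<kappa>)" using assms(6) by blast
  then show ?thesis by metis
qed

end

locale right_liftings = bicategory B for B :: "('o, 'm, 'c) bicat" (structure) +
  fixes D :: "('o, 'm, 'c) lifting_data"
  assumes lifting: "lifting_structure B D"
begin

lemma ob_simps [simp]:
  assumes "x \<in> Obj B"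
  shows "t_ob D x \<in> Obj B" "eps_ob D x \<in> Arr B"
    "src B (eps_ob D x) = t_ob D x" "tgt B (eps_ob D x) = x"
    "t_arr D (idarr B x) = eps_ob D x" "t_arr D (eps_ob D x) = idarr B (t_ob D x)"
    "eps_arr D (eps_ob D x) = runit B (eps_ob D x)"
  using lifting assms by (auto simp: lifting_structure_def arrow_def)

lemma arr_simps [simp]:
  assumes "f \<in> Arr B"
  shows "t_arr D f \<in> Arr B" "src B (t_arr D f) = t_ob D (tgt B f)" "tgt B (t_arr D f) = src B f"
    "eps_arr D f \<in> Cell B" "csrc B (eps_arr D f) = f \<odot> t_arr D f"
    "ctgt B (eps_arr D f) = eps_ob D (tgt B f)"
  using lifting assms unfolding lifting_structure_def by (auto simp: arrow_def cell_def)

lemma lifting_ex1: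
  assumes "f \<in> Arr B" "k \<in> Arr B" "src B k = t_ob D (tgt B f)" "tgt B k = src B f"
    "cell B \<beta> (f \<odot> k) (eps_ob D (tgt B f))"
  shows "\<exists>!\<kappa>. cell B \<kappa> k (t_arr D f) \<and> eps_arr D f \<cdot> (idcell B f \<star> \<kappa>) = \<beta>"
proof (rule right_lifting_ex1)
  show "right_lifting B (t_arr D f) (eps_ob D (tgt B f)) f (eps_arr D f)"
    using lifting assms(1) by (auto simp: lifting_structure_def arrow_def)
qed (use assms in \<open>auto simp: arrow_def\<close>)

lemma lifting_cancel:
  assumes f: "f \<in> Arr B" and \<kappa>: "cell B \<kappa> k (t_arr D f)" and \<kappa>': "cell B \<kappa>' k (t_arr D f)"
    and eq: "eps_arr D f \<cdot> (idcell B f \<star> \<kappa>) = eps_arr D f \<cdot> (idcell B f \<star> \<kappa>')"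
  shows "\<kappa> = \<kappa>'"
proof -
  have k: "k \<in> Arr B" "src B k = t_ob D (tgt B f)" "tgt B k = src B f"
    using \<kappa> f src_ctgt[of \<kappa>] tgt_ctgt[of \<kappa>] by (auto simp: cell_def)
  have "cell B (eps_arr D f \<cdot> (idcell B f \<star> \<kappa>)) (f \<odot> k) (eps_ob D (tgt B f))"
    using \<kappa> f k by (simp add: cell_def)
  from lifting_ex1[OF f k this] show ?thesis using \<kappa> \<kappa>' eq by metis
qed

text \<open>
  As the associator is invertible, the equation prescribes \<open>\<epsilon>\<^sub>g \<cdot> (g \<star> \<tau>)\<close>, and \<open>\<epsilon>\<^sub>g\<close> is a right
  lifting.
\<close>

lemma mate_ex1:
  assumes [simp]: "f \<in> Arr B" "g \<in> Arr B" "tgt B f = src B g"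
    and \<alpha>: "cell B \<alpha> (g \<odot> f) h"
  shows "\<exists>!\<tau>. mate B D f g h \<alpha> \<tau>"
proof -
  have [simp]: "h \<in> Arr B" "src B h = src B f" "tgt B h = tgt B g"
    "\<alpha> \<in> Cell B" "csrc B \<alpha> = g \<odot> f" "ctgt B \<alpha> = h"
    using \<alpha> src_ctgt[of \<alpha>] tgt_ctgt[of \<alpha>] by (auto simp: cell_def)
  let ?th = "t_arr D h" and ?a = "assoc B g f (t_arr D h)"
  let ?rhs = "eps_arr D h \<cdot> (\<alpha> \<star> idcell B ?th)"
  have iso: "iso_cell B ?a ((g \<odot> f) \<odot> ?th) (g \<odot> (f \<odot> ?th))"
    by (rule assoc_iso') auto
  then obtain a' where [simp]: "a' \<in> Cell B" "csrc B a' = g \<odot> (f \<odot> ?th)" "ctgt B a' = (g \<odot> f) \<odot> ?th"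
      "a' \<cdot> ?a = idcell B ((g \<odot> f) \<odot> ?th)"
    by (auto simp: iso_cell_def cell_def)
  have "\<exists>!\<tau>. cell B \<tau> (f \<odot> ?th) (t_arr D g) \<and>
      eps_arr D g \<cdot> (idcell B g \<star> \<tau>) = ?rhs \<cdot> a'"
    by (rule lifting_ex1) (auto simp: cell_def)
  moreover have "eps_arr D g \<cdot> (idcell B g \<star> \<tau>) = ?rhs \<cdot> a' \<longleftrightarrow>
      eps_arr D g \<cdot> (idcell B g \<star> \<tau>) \<cdot> ?a = ?rhs" (is "?P \<longleftrightarrow> ?Q")
    if [simp]: "\<tau> \<in> Cell B" "csrc B \<tau> = f \<odot> ?th" "ctgt B \<tau> = t_arr D g" for \<tau>
  proof
    assume ?P
    then have "(eps_arr D g \<cdot> (idcell B g \<star> \<tau>)) \<cdot> ?a = (?rhs \<cdot> a') \<cdot> ?a" by metis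
    then show ?Q by simp
  next
    assume Q: ?Q
    have "(eps_arr D g \<cdot> (idcell B g \<star> \<tau>)) \<cdot> ?a = (?rhs \<cdot> a') \<cdot> ?a" using Q by simp
    then show ?P
      by (rule iso_cancel_right[OF iso, rotated -1]) (auto simp: cell_def)
  qed
  ultimately show ?thesis
    unfolding mate_def cell_def by (metis (no_types, lifting))
qed

lemma mate_cell:
  assumes "mate B D f g h \<alpha> \<tau>"
  shows "\<tau> \<in> Cell B" "csrc B \<tau> = f \<odot> t_arr D h" "ctgt B \<tau> = t_arr D g"
  using assms by (auto simp: mate_def cell_def)

lemma mate_eq:
  assumes "mate B D f g h \<alpha> \<tau>"
  shows "eps_arr D g \<cdot> (idcell B g \<star> \<tau>) \<cdot> assoc B g f (t_arr D h) =
    eps_arr D h \<cdot> (\<alpha> \<star> idcell B (t_arr D h))"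
  using assms by (auto simp: mate_def)

text \<open>
  The mates of \<open>runit f\<close>, \<open>\<epsilon>\<^sub>f\<close> and \<open>lunit f\<close> are those needed for compatibility with degeneracies
  of 1-simplices. The first is the triangle identity.
\<close>

lemma mate_runit:
  assumes [simp]: "f \<in> Arr B" "x = src B f"
  shows "mate B D (idarr B x) f f (runit B f) (lunit B (t_arr D f))"
  using triangle'[of "t_arr D f" f "src B f"] by (simp add: mate_def cell_def)

text \<open>
  Here \<open>\<epsilon>\<close> at \<open>\<epsilon>\<^sub>x = t 1\<^sub>x\<close> enters, which is a right unit constraint.
\<close>

lemma mate_eps:
  assumes [simp]: "f \<in> Arr B" "x = tgt B f"
  shows "mate B D (t_arr D f) f (eps_ob D x) (eps_arr D f) (runit B (t_arr D f))"
proof -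
  let ?i = "idarr B (t_ob D x)"
  have "eps_arr D f \<cdot> runit B (f \<odot> t_arr D f) = runit B (eps_ob D x) \<cdot> (eps_arr D f \<star> idcell B ?i)"
    by (rule runit_natural'[symmetric]) auto
  then show ?thesis by (simp add: mate_def cell_def runit_comp)
qed

text \<open>
  Here \<open>\<epsilon>\<close> at \<open>1\<^sub>x\<close> enters, which is a left unit constraint by normality.
\<close>

lemma mate_lunit:
  assumes "normal B D" and [simp]: "f \<in> Arr B" "x = tgt B f"
  shows "mate B D f (idarr B x) f (lunit B f) (eps_arr D f)"
proof -
  let ?i = "idarr B x"
  have [simp]: "eps_arr D (idarr B (tgt B f)) = lunit B (eps_ob D (tgt B f))"
    using assms by (simp add: normal_def)
  have "lunit B (eps_ob D x) \<cdot> (idcell B ?i \<star> eps_arr D f) \<cdot> assoc B ?i f (t_arr D f) =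
      (eps_arr D f \<cdot> lunit B (f \<odot> t_arr D f)) \<cdot> assoc B ?i f (t_arr D f)"
    by (rule vcomp_cong_head[OF lunit_natural']) auto
  also have "\<dots> = eps_arr D f \<cdot> (lunit B f \<star> idcell B (t_arr D f))"
    by (simp add: lunit_comp)
  finally show ?thesis by (simp add: mate_def cell_def)
qed

text \<open>
  The hypotheses on \<open>\<alpha>, \<beta>, \<gamma>, \<delta>\<close> say that they form a 3-simplex, and the conclusion is the equation
  for its rotation, whose triangles are \<open>\<beta>\<close> and the mates of \<open>\<alpha>, \<gamma>, \<delta>\<close>. Both sides have target
  \<open>t h\<close>, so it suffices to compare them after composing with \<open>\<epsilon>\<^sub>h\<close>. The mate equations of \<open>\<gamma>\<close> on the
  left, and of \<open>\<alpha>\<close> and then \<open>\<delta>\<close> on the right, turn both composites into \<open>\<epsilon>\<^sub>m\<close> after the two sides of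
  the given equation; the associators agree by the pentagon for \<open>h, g, f, t m\<close>.
\<close>

lemma mate_pasting:
  assumes [simp]: "f \<in> Arr B" "g \<in> Arr B" "h \<in> Arr B" "tgt B f = src B g" "tgt B g = src B h"
    and cells: "cell B \<alpha> (h \<odot> g) l" "cell B \<beta> (g \<odot> f) k" "cell B \<gamma> (h \<odot> k) m" "cell B \<delta> (l \<odot> f) m"
    and eq: "\<delta> \<cdot> (\<alpha> \<star> idcell B f) = \<gamma> \<cdot> (idcell B h \<star> \<beta>) \<cdot> assoc B h g f"
    and mates: "mate B D g h l \<alpha> \<alpha>'" "mate B D k h m \<gamma> \<gamma>'" "mate B D f l m \<delta> \<delta>'"
  shows "\<gamma>' \<cdot> (\<beta> \<star> idcell B (t_arr D m)) = \<alpha>' \<cdot> (idcell B g \<star> \<delta>') \<cdot> assoc B g f (t_arr D m)"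
proof -
  have [simp]: "\<alpha> \<in> Cell B" "csrc B \<alpha> = h \<odot> g" "ctgt B \<alpha> = l"
      "\<beta> \<in> Cell B" "csrc B \<beta> = g \<odot> f" "ctgt B \<beta> = k"
      "\<gamma> \<in> Cell B" "csrc B \<gamma> = h \<odot> k" "ctgt B \<gamma> = m"
      "\<delta> \<in> Cell B" "csrc B \<delta> = l \<odot> f" "ctgt B \<delta> = m"
    using cells by (auto simp: cell_def)
  have [simp]: "k \<in> Arr B" "src B k = src B f" "tgt B k = src B h"
      "l \<in> Arr B" "src B l = src B g" "tgt B l = tgt B h"
    using src_ctgt[of \<beta>] tgt_ctgt[of \<beta>] ctgt_Arr[of \<beta>] src_ctgt[of \<alpha>] tgt_ctgt[of \<alpha>] ctgt_Arr[of \<alpha>]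
    by auto
  have [simp]: "m \<in> Arr B" "src B m = src B f" "tgt B m = tgt B h"
    using src_ctgt[of \<gamma>] tgt_ctgt[of \<gamma>] ctgt_Arr[of \<gamma>] by auto
  note [simp] = mate_cell[OF mates(1)] mate_cell[OF mates(2)] mate_cell[OF mates(3)]
  let ?m = "t_arr D m" and ?i = "idcell B" and ?a = "assoc B"
  let ?tm = "idcell B (t_arr D m)"
  let ?\<epsilon> = "eps_arr D"
  let ?L = "\<gamma>' \<cdot> (\<beta> \<star> ?tm)" and ?R = "\<alpha>' \<cdot> (?i g \<star> \<delta>') \<cdot> ?a g f ?m"
  let ?\<phi> = "?a h (g \<odot> f) ?m" and ?\<theta> = "?a h g f \<star> ?tm"
  have "((?\<epsilon> h \<cdot> (?i h \<star> ?L)) \<cdot> ?\<phi>) \<cdot> ?\<theta> =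
      ?\<epsilon> h \<cdot> (?i h \<star> \<gamma>') \<cdot> ((?i h \<star> (\<beta> \<star> ?tm)) \<cdot> ?\<phi>) \<cdot> ?\<theta>"
    by (simp add: whisker_vcomp)
  also have "(?i h \<star> (\<beta> \<star> ?tm)) \<cdot> ?\<phi> = ?a h k ?m \<cdot> ((?i h \<star> \<beta>) \<star> ?tm)"
    using assoc_natural'[of ?tm \<beta> "?i h"] by simp
  also have "?\<epsilon> h \<cdot> (?i h \<star> \<gamma>') \<cdot> (?a h k ?m \<cdot> ((?i h \<star> \<beta>) \<star> ?tm)) \<cdot> ?\<theta>
      = (?\<epsilon> h \<cdot> (?i h \<star> \<gamma>') \<cdot> ?a h k ?m) \<cdot> ((?i h \<star> \<beta>) \<star> ?tm) \<cdot> ?\<theta>"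
    by simp
  also have "?\<epsilon> h \<cdot> (?i h \<star> \<gamma>') \<cdot> ?a h k ?m = ?\<epsilon> m \<cdot> (\<gamma> \<star> ?tm)"
    by (rule mate_eq[OF mates(2)])
  also have "(?\<epsilon> m \<cdot> (\<gamma> \<star> ?tm)) \<cdot> ((?i h \<star> \<beta>) \<star> ?tm) \<cdot> ?\<theta> =
      ?\<epsilon> m \<cdot> ((\<gamma> \<cdot> (?i h \<star> \<beta>) \<cdot> ?a h g f) \<star> ?tm)"
    by (simp add: whisker_vcomp)
  also have "\<dots> = ?\<epsilon> m \<cdot> ((\<delta> \<cdot> (\<alpha> \<star> ?i f)) \<star> ?tm)"
    by (simp only: eq)
  also have "\<dots> = (?\<epsilon> m \<cdot> (\<delta> \<star> ?tm)) \<cdot> ((\<alpha> \<star> ?i f) \<star> ?tm)"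
    by (simp add: whisker_vcomp)
  also have "?\<epsilon> m \<cdot> (\<delta> \<star> ?tm) = ?\<epsilon> l \<cdot> (?i l \<star> \<delta>') \<cdot> ?a l f ?m"
    by (rule mate_eq[OF mates(3), symmetric])
  also have "(?\<epsilon> l \<cdot> (?i l \<star> \<delta>') \<cdot> ?a l f ?m) \<cdot> ((\<alpha> \<star> ?i f) \<star> ?tm) =
      ?\<epsilon> l \<cdot> (?i l \<star> \<delta>') \<cdot> (?a l f ?m \<cdot> ((\<alpha> \<star> ?i f) \<star> ?tm))"
    by simp
  also have "?a l f ?m \<cdot> ((\<alpha> \<star> ?i f) \<star> ?tm) = (\<alpha> \<star> ?i (f \<odot> ?m)) \<cdot> ?a (h \<odot> g) f ?m"
    using assoc_natural'[of ?tm "?i f" \<alpha>] by simp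
  also have "?\<epsilon> l \<cdot> (?i l \<star> \<delta>') \<cdot> ((\<alpha> \<star> ?i (f \<odot> ?m)) \<cdot> ?a (h \<odot> g) f ?m) =
      ?\<epsilon> l \<cdot> ((?i l \<star> \<delta>') \<cdot> (\<alpha> \<star> ?i (f \<odot> ?m))) \<cdot> ?a (h \<odot> g) f ?m"
    by simp
  also have "(?i l \<star> \<delta>') \<cdot> (\<alpha> \<star> ?i (f \<odot> ?m)) = (\<alpha> \<star> ?i (t_arr D l)) \<cdot> (?i (h \<odot> g) \<star> \<delta>')"
    by (rule whisker_exchange) auto
  also have "?\<epsilon> l \<cdot> ((\<alpha> \<star> ?i (t_arr D l)) \<cdot> (?i (h \<odot> g) \<star> \<delta>')) \<cdot> ?a (h \<odot> g) f ?m =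
      (?\<epsilon> l \<cdot> (\<alpha> \<star> ?i (t_arr D l))) \<cdot> (?i (h \<odot> g) \<star> \<delta>') \<cdot> ?a (h \<odot> g) f ?m"
    by simp
  also have "?\<epsilon> l \<cdot> (\<alpha> \<star> ?i (t_arr D l)) = ?\<epsilon> h \<cdot> (?i h \<star> \<alpha>') \<cdot> ?a h g (t_arr D l)"
    by (rule mate_eq[OF mates(1), symmetric])
  also have "(?\<epsilon> h \<cdot> (?i h \<star> \<alpha>') \<cdot> ?a h g (t_arr D l)) \<cdot> (?i (h \<odot> g) \<star> \<delta>') \<cdot> ?a (h \<odot> g) f ?m =
      ?\<epsilon> h \<cdot> (?i h \<star> \<alpha>') \<cdot> (?a h g (t_arr D l) \<cdot> (?i (h \<odot> g) \<star> \<delta>')) \<cdot> ?a (h \<odot> g) f ?m"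
    by simp
  also have "?a h g (t_arr D l) \<cdot> (?i (h \<odot> g) \<star> \<delta>') = (?i h \<star> (?i g \<star> \<delta>')) \<cdot> ?a h g (f \<odot> ?m)"
    using assoc_natural'[of \<delta>' "?i g" "?i h"] by simp
  also have "?\<epsilon> h \<cdot> (?i h \<star> \<alpha>') \<cdot> ((?i h \<star> (?i g \<star> \<delta>')) \<cdot> ?a h g (f \<odot> ?m)) \<cdot> ?a (h \<odot> g) f ?m =
      ?\<epsilon> h \<cdot> (?i h \<star> \<alpha>') \<cdot> (?i h \<star> (?i g \<star> \<delta>')) \<cdot> (?a h g (f \<odot> ?m) \<cdot> ?a (h \<odot> g) f ?m)"
    by simp
  also have "?a h g (f \<odot> ?m) \<cdot> ?a (h \<odot> g) f ?m = (?i h \<star> ?a g f ?m) \<cdot> ?\<phi> \<cdot> ?\<theta>"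
    by (rule pentagon') auto
  also have "?\<epsilon> h \<cdot> (?i h \<star> \<alpha>') \<cdot> (?i h \<star> (?i g \<star> \<delta>')) \<cdot> ((?i h \<star> ?a g f ?m) \<cdot> ?\<phi> \<cdot> ?\<theta>) =
      ((?\<epsilon> h \<cdot> (?i h \<star> ?R)) \<cdot> ?\<phi>) \<cdot> ?\<theta>"
    by (simp add: whisker_vcomp)
  finally have *: "((?\<epsilon> h \<cdot> (?i h \<star> ?L)) \<cdot> ?\<phi>) \<cdot> ?\<theta> = ((?\<epsilon> h \<cdot> (?i h \<star> ?R)) \<cdot> ?\<phi>) \<cdot> ?\<theta>" .
  have "(?\<epsilon> h \<cdot> (?i h \<star> ?L)) \<cdot> ?\<phi> = (?\<epsilon> h \<cdot> (?i h \<star> ?R)) \<cdot> ?\<phi>"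
    by (rule iso_cancel_right[OF iso_whisker_right[OF assoc_iso'] _ _ *]) (auto simp: cell_def)
  then have "?\<epsilon> h \<cdot> (?i h \<star> ?L) = ?\<epsilon> h \<cdot> (?i h \<star> ?R)"
    by (rule iso_cancel_right[OF assoc_iso', rotated -1]) (auto simp: cell_def)
  then show ?thesis
    by (rule lifting_cancel[rotated -1]) (auto simp: cell_def)
qed

end

section \<open>The nerve as a simplicial set\<close>

context bicategory
begin

abbreviation X where "X \<equiv> nerve_simplices B"
abbreviation d where "d \<equiv> nerve_face B"
abbreviation s where "s \<equiv> nerve_degen B"

lemma S0_in_nerve [simp]: "S0 x \<in> X 0 \<longleftrightarrow> x \<in> Obj B"
  and S1_in_nerve [simp]: "S1 f \<in> X (Suc 0) \<longleftrightarrow> f \<in> Arr B"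
  by auto

lemma S2_in_nerve [simp]:
  "S2 f g h \<alpha> \<in> X (Suc (Suc 0)) \<longleftrightarrow>
     f \<in> Arr B \<and> g \<in> Arr B \<and> tgt B f = src B g \<and> cell B \<alpha> (g \<odot> f) h"
  using cell_ends[of \<alpha>] by (auto simp: arrow_def cell_def)

text \<open>
  The boundaries of the 2-cells force those of the edges \<open>k\<close>, \<open>l\<close>, \<open>m\<close>.
\<close>

lemma S3_in_nerve [simp]:
  "S3 f g h k l m \<alpha> \<beta> \<gamma> \<delta> \<in> X (Suc (Suc (Suc 0))) \<longleftrightarrow>
     f \<in> Arr B \<and> g \<in> Arr B \<and> h \<in> Arr B \<and> tgt B f = src B g \<and> tgt B g = src B h \<and>
     cell B \<alpha> (h \<odot> g) l \<and> cell B \<beta> (g \<odot> f) k \<and> cell B \<gamma> (h \<odot> k) m \<and> cell B \<delta> (l \<odot> f) m \<and>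
     \<delta> \<cdot> (\<alpha> \<star> idcell B f) = \<gamma> \<cdot> (idcell B h \<star> \<beta>) \<cdot> assoc B h g f" (is "?L \<longleftrightarrow> ?R")
proof
  assume R: ?R
  then have kl: "k \<in> Arr B" "src B k = src B f" "tgt B k = src B h"
      "l \<in> Arr B" "src B l = src B g" "tgt B l = tgt B h"
    using cell_ends[of \<beta>] cell_ends[of \<alpha>] by (auto simp: cell_def)
  moreover have "m \<in> Arr B" "src B m = src B f" "tgt B m = tgt B h"
    using R kl cell_ends[of \<gamma>] by (auto simp: cell_def)
  ultimately show ?L using R by (auto simp: arrow_def)
qed (auto simp: arrow_def)

declare nerve_simplices.simps(3,4) [simp del]

lemma S2_ends:
  assumes "S2 f g h \<alpha> \<in> X (Suc (Suc 0))"
  shows "h \<in> Arr B" "src B h = src B f" "tgt B h = tgt B g"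
  using assms cell_ends[of \<alpha>] by (auto simp: cell_def)

lemma nerve_cases:
  assumes "\<sigma> \<in> X n"
  obtains
    (0) x where "n = 0" "\<sigma> = S0 x"
  | (1) f where "n = Suc 0" "\<sigma> = S1 f"
  | (2) f g h \<alpha> where "n = Suc (Suc 0)" "\<sigma> = S2 f g h \<alpha>"
  | (3) f g h k l m \<alpha> \<beta> \<gamma> \<delta> where "n = Suc (Suc (Suc 0))" "\<sigma> = S3 f g h k l m \<alpha> \<beta> \<gamma> \<delta>"
  | (N) p \<sigma>s where "n = Suc (Suc (Suc (Suc p)))" "\<sigma> = SN \<sigma>s" "length \<sigma>s = p + 5"
proof -
  consider "n = 0" | "n = Suc 0" | "n = Suc (Suc 0)" | "n = Suc (Suc (Suc 0))"
    | p where "n = Suc (Suc (Suc (Suc p)))"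
    by (metis not0_implies_Suc)
  then show thesis using assms that by cases (auto simp: nerve_simplices.simps(3,4))
qed

lemma face_in_nerve:
  assumes "\<sigma> \<in> X (Suc n)" "i \<le> Suc n"
  shows "d i \<sigma> \<in> X n"
  using assms(1)
proof (cases rule: nerve_cases)
  case (2 f g h \<alpha>)
  then show ?thesis using S2_ends[of f g h \<alpha>] assms by auto
next
  case (3 f g h k l m \<alpha> \<beta> \<gamma> \<delta>)
  then have \<alpha>: "S2 g h l \<alpha> \<in> X (Suc (Suc 0))" and \<beta>: "S2 f g k \<beta> \<in> X (Suc (Suc 0))"
    using assms(1) S3_in_nerve[of f g h k l m \<alpha> \<beta> \<gamma> \<delta>] by auto
  show ?thesis
    using 3 assms S2_ends[OF \<alpha>] S2_ends[OF \<beta>] S3_in_nerve[of f g h k l m \<alpha> \<beta> \<gamma> \<delta>] by auto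
qed (use assms in auto)

lemma face_face:
  assumes "\<sigma> \<in> X (Suc (Suc n))" "i \<le> j" "j \<le> Suc n"
  shows "d i (d (Suc j) \<sigma>) = d j (d i \<sigma>)"
  using assms(1)
proof (cases rule: nerve_cases)
  case (2 f g h \<alpha>)
  have "j = 0 \<or> j = Suc 0" using 2 assms by auto
  then show ?thesis using 2 S2_ends[of f g h \<alpha>] assms by auto
next
  case (3 f g h k l m \<alpha> \<beta> \<gamma> \<delta>)
  have "j = 0 \<or> j = Suc 0 \<or> j = Suc (Suc 0)" "i = 0 \<or> i = Suc 0 \<or> i = Suc (Suc 0)"
    using 3 assms by auto
  then show ?thesis using 3 assms by auto
next
  case (N p \<sigma>s)
  then have "\<forall>j<p + 5. \<forall>i<j. d i (\<sigma>s ! j) = d (j - 1) (\<sigma>s ! i)" using assms(1) by auto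
  then show ?thesis using N assms by auto
qed simp_all

lemma SN_in_nerve:
  assumes "length \<sigma>s = p + 5"
    and "\<And>j. j \<le> p + 4 \<Longrightarrow> \<sigma>s ! j \<in> X (Suc (Suc (Suc p)))"
    and "\<And>i j. i \<le> j \<Longrightarrow> j \<le> p + 3 \<Longrightarrow> d i (\<sigma>s ! Suc j) = d j (\<sigma>s ! i)"
  shows "SN \<sigma>s \<in> X (Suc (Suc (Suc (Suc p))))"
proof -
  have "d i (\<sigma>s ! j) = d (j - 1) (\<sigma>s ! i)" if "j < p + 5" "i < j" for i j
    using assms(3)[of i "j - 1"] that by (cases j) auto
  moreover have "\<sigma>s ! j \<in> X (Suc (Suc (Suc p)))" if "j < p + 5" for j
    using assms(2) that by simp
  ultimately show ?thesis using assms(1) by (auto simp: in_set_conv_nth)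
qed

text \<open>
  In dimension 3 the faces are the four 2-cells, and a 3-simplex adds to them only an equation.
\<close>

lemma nerve_eqI:
  assumes "\<sigma> \<in> X n" "\<tau> \<in> X n" "n \<ge> 3" "\<And>i. i \<le> n \<Longrightarrow> d i \<sigma> = d i \<tau>"
  shows "\<sigma> = \<tau>"
proof -
  have "n = Suc (Suc (Suc (n - 3)))" using \<open>n \<ge> 3\<close> by simp
  then consider "n = Suc (Suc (Suc 0))" | p where "n = Suc (Suc (Suc (Suc p)))"
    by (cases "n - 3") auto
  then show ?thesis
  proof cases
    case 1
    then show ?thesis
      using assms(1,2) assms(4)[of 0] assms(4)[of 1] assms(4)[of 2] assms(4)[of 3]
      by (auto simp: nerve_simplices.simps(4))
  next
    case (2 p)
    then obtain \<sigma>s \<tau>s where "\<sigma> = SN \<sigma>s" "\<tau> = SN \<tau>s" "length \<sigma>s = p + 5" "length \<tau>s = p + 5"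
      using assms(1,2) by auto
    moreover have "\<sigma>s ! i = \<tau>s ! i" if "i < p + 5" for i
      using assms(4)[of i] that 2 calculation by auto
    ultimately show ?thesis by (simp add: list_eq_iff_nth_eq)
  qed
qed

text \<open>
  The three cases agree with the simplicial identities proved below for all dimensions. From
  dimension 3 on they hold by definition, also on arguments outside the nerve.
\<close>

lemma face_degen_high:
  assumes "n \<ge> 3" "j \<le> Suc n"
  shows "d j (s n i \<sigma>) =
    (if j < i then s (n - 1) (i - 1) (d j \<sigma>) else if j \<le> i + 1 then \<sigma>
     else s (n - 1) i (d (j - 1) \<sigma>))"
proof -
  define p where "p = n - 3"
  have n: "n = Suc (Suc (Suc p))" using \<open>n \<ge> 3\<close> by (simp add: p_def)
  show ?thesis using assms unfolding n by (auto simp: nth_append simp del: upt_Suc)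
qed

lemma face_degen_less:
  assumes "\<sigma> \<in> X (Suc n)" "j \<le> i" "i \<le> n"
  shows "d j (s (Suc n) (Suc i) \<sigma>) = s n i (d j \<sigma>)"
  using assms(1)
proof (cases rule: nerve_cases)
  case (1 f)
  then show ?thesis using assms by auto
next
  case (2 f g h \<alpha>)
  then have "i = 0 \<or> i = Suc 0" "j = 0 \<or> j = Suc 0" using assms by auto
  then show ?thesis using 2 S2_ends[of f g h \<alpha>] assms by auto
qed (use assms in \<open>auto simp: face_degen_high\<close>)

lemma face_degen_eq:
  assumes "\<sigma> \<in> X n" "i \<le> n"
  shows "d i (s n i \<sigma>) = \<sigma>" "d (Suc i) (s n i \<sigma>) = \<sigma>"
proof -
  have "d i (s n i \<sigma>) = \<sigma> \<and> d (Suc i) (s n i \<sigma>) = \<sigma>"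
    using assms(1)
  proof (cases rule: nerve_cases)
    case (2 f g h \<alpha>)
    then have "i = 0 \<or> i = Suc 0 \<or> i = Suc (Suc 0)" using assms by auto
    then show ?thesis using 2 by auto
  qed (use assms in \<open>auto simp: face_degen_high\<close>)
  then show "d i (s n i \<sigma>) = \<sigma>" "d (Suc i) (s n i \<sigma>) = \<sigma>" by auto
qed

lemma face_degen_greater:
  assumes "\<sigma> \<in> X (Suc n)" "i < j" "j \<le> Suc n"
  shows "d (Suc j) (s (Suc n) i \<sigma>) = s n i (d j \<sigma>)"
  using assms(1)
proof (cases rule: nerve_cases)
  case (1 f)
  then show ?thesis using assms by auto
next
  case (2 f g h \<alpha>)
  then have "i = 0 \<or> i = Suc 0" "j = Suc 0 \<or> j = Suc (Suc 0)" using assms by auto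
  then show ?thesis using 2 S2_ends[of f g h \<alpha>] assms by auto
qed (use assms in \<open>auto simp: face_degen_high\<close>)

text \<open>
  The three degeneracies of a 2-simplex are 3-simplices by \<open>runit_comp\<close>, the triangle identity and
  \<open>lunit_comp\<close>. In higher dimensions, the prescribed faces match by the simplicial identities one
  dimension below.
\<close>

lemma degen_in_nerve:
  assumes "\<sigma> \<in> X n" "i \<le> n"
  shows "s n i \<sigma> \<in> X (Suc n)"
  using assms
proof (induction n arbitrary: \<sigma> i)
  case 0
  then show ?case by auto
next
  case (Suc m)
  show ?case
  proof (cases "Suc m < 3")
    case True
    show ?thesis
      using Suc.prems(1)
    proof (cases rule: nerve_cases)
      case (1 f)
      then show ?thesis using Suc.prems by (auto simp: cell_def)
    next
      case (2 f g h \<alpha>)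
      then have [simp]: "f \<in> Arr B" "g \<in> Arr B" "tgt B f = src B g"
          "\<alpha> \<in> Cell B" "csrc B \<alpha> = g \<odot> f" "ctgt B \<alpha> = h"
          "h \<in> Arr B" "src B h = src B f" "tgt B h = tgt B g"
        using Suc.prems(1) S2_ends[of f g h \<alpha>] by (auto simp: cell_def)
      have "runit B h \<cdot> (\<alpha> \<star> idcell B (idarr B (src B f))) =
          \<alpha> \<cdot> (idcell B g \<star> runit B f) \<cdot> assoc B g f (idarr B (src B f))"
        by (simp add: runit_natural' runit_comp)
      moreover have "\<alpha> \<cdot> (runit B g \<star> idcell B f) =
          \<alpha> \<cdot> (idcell B g \<star> lunit B f) \<cdot> assoc B g (idarr B (src B g)) f"
        by (simp add: triangle')
      moreover have "lunit B h \<cdot> (idcell B (idarr B (tgt B g)) \<star> \<alpha>) \<cdot> assoc B (idarr B (tgt B g)) g f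
          = \<alpha> \<cdot> (lunit B g \<star> idcell B f)"
        using vcomp_cong_head[OF lunit_natural'[of \<alpha> "g \<odot> f" h "tgt B g"], of "assoc B (idarr B (tgt B g)) g f"]
        by (simp add: lunit_comp)
      moreover have "i = 0 \<or> i = Suc 0 \<or> i = Suc (Suc 0)" using 2 Suc.prems(2) by auto
      ultimately show ?thesis using 2 by (auto simp: cell_def)
    qed (use True Suc.prems in auto)
  next
    case False
    define p where "p = m - 2"
    have m: "m = Suc (Suc p)" using False by (simp add: p_def)
    note \<sigma> = Suc.prems(1)
    have fc: "d j \<sigma> \<in> X (Suc (Suc p))" if "j \<le> Suc m" for j
      using face_in_nerve[OF \<sigma> that] by (simp add: m)
    define e where "e j = d j (s (Suc m) i \<sigma>)" for j
    have e: "e j = (if j < i then s m (i - 1) (d j \<sigma>) else if j \<le> i + 1 then \<sigma>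
        else s m i (d (j - 1) \<sigma>))" if "j \<le> Suc (Suc m)" for j
      using that False by (simp add: e_def face_degen_high)
    have "e j \<in> X (Suc m)" if "j \<le> Suc (Suc m)" for j
      unfolding e[OF that] using that Suc.prems
      by (auto simp flip: m intro!: Suc.IH face_in_nerve)
    moreover have "d a (e (Suc c)) = d c (e a)" if ac: "a \<le> c" "c \<le> Suc m" for a c
    proof -
      \<comment> \<open>The faces \<open>i\<close> and \<open>i + 1\<close> are \<open>\<sigma>\<close>; each of \<open>a\<close> and \<open>c + 1\<close> lies below, in or above this pair.\<close>
      consider "Suc c < i" | "a < i" "c = i \<or> Suc c = i" | "a = i" "c = i"
        | "a < i" "c > i" | "a = i \<or> a = Suc i" "c > i" | "a > Suc i" "c > i"
        using ac by linarith
      then show ?thesis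
      proof cases
        case 1
        then obtain r where r: "i = Suc (Suc r)" "c \<le> r"
          by (cases i; cases "i - 1") auto
        have "d a (d (Suc c) \<sigma>) = d c (d a \<sigma>)"
          using face_face[OF \<sigma>[unfolded m], of a c] ac 1 Suc.prems(2) m by auto
        then show ?thesis
          using 1 r ac Suc.prems(2) by (simp add: e face_degen_less[OF fc] m)
      next
        case 2
        then obtain r where r: "i = Suc r" by (metis less_imp_Suc_add)
        have "d r (s m r (d a \<sigma>)) = d a \<sigma>" "d (Suc r) (s m r (d a \<sigma>)) = d a \<sigma>"
          using face_degen_eq[OF fc, of a r] ac 2 r Suc.prems(2) by (simp_all add: m)
        then show ?thesis using 2 r ac by (auto simp: e)
      next
        case 3
        then show ?thesis using ac by (simp add: e)
      next
        case 4
        then obtain r where r: "i = Suc r" by (metis less_imp_Suc_add)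
        obtain c' where c': "c = Suc c'" using 4 by (metis less_imp_Suc_add)
        have "d a (d c \<sigma>) = d c' (d a \<sigma>)"
          using face_face[OF \<sigma>[unfolded m], of a c'] ac 4 m c' by auto
        then show ?thesis
          using 4 r c' ac by (simp add: e face_degen_less[OF fc] face_degen_greater[OF fc] m)
      next
        case 5
        have "d i (s m i (d c \<sigma>)) = d c \<sigma>" "d (Suc i) (s m i (d c \<sigma>)) = d c \<sigma>"
          using face_degen_eq[OF fc, of c i] ac 5 by (simp_all add: m)
        then show ?thesis using 5 ac by (auto simp: e)
      next
        case 6
        obtain a' where a': "a = Suc a'" using 6 by (metis less_imp_Suc_add)
        obtain c' where c': "c = Suc c'" using 6 by (metis less_imp_Suc_add)
        have "d a' (d c \<sigma>) = d c' (d a' \<sigma>)"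
          using face_face[OF \<sigma>[unfolded m], of a' c'] ac 6 m c' a' by auto
        then show ?thesis
          using 6 a' c' ac by (simp add: e face_degen_greater[OF fc] m)
      qed
    qed
    moreover obtain \<sigma>s where \<sigma>s: "s (Suc m) i \<sigma> = SN \<sigma>s" "length \<sigma>s = p + 5" by (simp add: m)
    moreover have "\<sigma>s ! j = e j" for j by (simp add: e_def \<sigma>s)
    ultimately have "SN \<sigma>s \<in> X (Suc (Suc (Suc (Suc p))))"
      by (intro SN_in_nerve) (simp_all add: m)
    then show ?thesis using \<sigma>s(1) by (simp add: m)
  qed
qed

end

section \<open>Duplicial operators on the nerve\<close>

context bicategory
begin

text \<open>
  The conditions on faces and on degeneracies are separated, because the former determine an operator
  from its values in dimension at most 2 and imply the latter in high dimensions. Indices are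
  shifted so as to avoid truncated subtraction.
\<close>

definition duplicial_faces :: "(nat \<Rightarrow> ('o, 'm, 'c) simplex \<Rightarrow> ('o, 'm, 'c) simplex) \<Rightarrow> bool" where
  "duplicial_faces t \<longleftrightarrow>
     (\<forall>n. \<forall>\<sigma>\<in>X n. t n \<sigma> \<in> X n) \<and>
     (\<forall>n. \<forall>\<sigma>\<in>X (Suc n). d 0 (t (Suc n) \<sigma>) = d (Suc n) \<sigma> \<and>
        (\<forall>i\<le>n. d (Suc i) (t (Suc n) \<sigma>) = t n (d i \<sigma>)))"

definition duplicial_degens :: "(nat \<Rightarrow> ('o, 'm, 'c) simplex \<Rightarrow> ('o, 'm, 'c) simplex) \<Rightarrow> nat \<Rightarrow> bool" where
  "duplicial_degens t n \<longleftrightarrow> (\<forall>\<sigma>\<in>X n. s n 0 (t n \<sigma>) = t (Suc n) (t (Suc n) (s n n \<sigma>)) \<and>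
        (\<forall>i<n. s n (Suc i) (t n \<sigma>) = t (Suc n) (s n i \<sigma>)))"

lemma duplicial_structure_nerve:
  "duplicial_structure (nerve B) t \<longleftrightarrow>
     (\<forall>n. t n \<in> extensional (X n)) \<and> duplicial_faces t \<and> (\<forall>n. duplicial_degens t n)"
proof -
  have "{1..n + 1} = Suc ` {..n}" "{1..n} = Suc ` {..<n}" for n
    by (simp_all add: image_Suc_atMost image_Suc_lessThan)
  note sets = this
  have all1: "(\<forall>i\<in>{1..n + 1}. P i) \<longleftrightarrow> (\<forall>i\<le>n. P (Suc i))" for P and n :: nat
    unfolding sets(1) by blast
  have all2: "(\<forall>i\<in>{1..n}. P i) \<longleftrightarrow> (\<forall>i<n. P (Suc i))" for P and n :: nat
    unfolding sets(2) by blast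
  show ?thesis
    unfolding duplicial_structure_def all1 unfolding all2 duplicial_faces_def duplicial_degens_def
    by (simp add: nerve_def PiE_iff all_conj_distrib ball_conj_distrib conj_ac)
qed

lemma duplicial_faces_simps:
  assumes "duplicial_faces t"
  shows "\<sigma> \<in> X n \<Longrightarrow> t n \<sigma> \<in> X n"
    and "\<sigma> \<in> X (Suc n) \<Longrightarrow> d 0 (t (Suc n) \<sigma>) = d (Suc n) \<sigma>"
    and "\<sigma> \<in> X (Suc n) \<Longrightarrow> i \<le> n \<Longrightarrow> d (Suc i) (t (Suc n) \<sigma>) = t n (d i \<sigma>)"
  using assms by (auto simp: duplicial_faces_def)

lemma duplicial_faces_unique:
  assumes t: "duplicial_faces t" and t': "duplicial_faces t'"
    and low: "\<And>n \<sigma>. n \<le> 2 \<Longrightarrow> \<sigma> \<in> X n \<Longrightarrow> t n \<sigma> = t' n \<sigma>"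
    and "\<sigma> \<in> X n"
  shows "t n \<sigma> = t' n \<sigma>"
  using \<open>\<sigma> \<in> X n\<close>
proof (induction n arbitrary: \<sigma>)
  case 0
  then show ?case by (simp add: low)
next
  case (Suc n)
  show ?case
  proof (cases "Suc n \<le> 2")
    case False
    show ?thesis
    proof (rule nerve_eqI)
      fix i assume i: "i \<le> Suc n"
      show "d i (t (Suc n) \<sigma>) = d i (t' (Suc n) \<sigma>)"
        using i Suc duplicial_faces_simps[OF t] duplicial_faces_simps[OF t'] face_in_nerve
        by (cases i) auto
    qed (use False Suc.prems t t' duplicial_faces_simps(1) in auto)
  qed (use low Suc.prems in auto)
qed

text \<open>
  In dimension at least 2, both sides of each equation are simplices of dimension at least 3, and are
  equal if their faces are. The face relations reduce all but the two faces that collapse the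
  degeneracy, and the zeroth face, to the same equation one dimension below.
\<close>

lemma duplicial_degens_from_low:
  assumes t: "duplicial_faces t" and low: "\<And>n. n < 2 \<Longrightarrow> duplicial_degens t n"
  shows "duplicial_degens t n"
proof (induction n)
  case 0
  then show ?case by (simp add: low)
next
  case (Suc m)
  note F = duplicial_faces_simps[OF t]
  show ?case
  proof (cases "Suc m < 2")
    case False
    have IH0: "s m 0 (t m \<sigma>) = t (Suc m) (t (Suc m) (s m m \<sigma>))"
      and IH: "\<And>i. i < m \<Longrightarrow> s m (Suc i) (t m \<sigma>) = t (Suc m) (s m i \<sigma>)" if "\<sigma> \<in> X m" for \<sigma>
      using Suc that by (auto simp: duplicial_degens_def)
    have "s (Suc m) 0 (t (Suc m) \<sigma>) = t (Suc (Suc m)) (t (Suc (Suc m)) (s (Suc m) (Suc m) \<sigma>))"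
      if \<sigma>: "\<sigma> \<in> X (Suc m)" for \<sigma>
    proof (rule nerve_eqI)
      have s\<sigma>: "s (Suc m) (Suc m) \<sigma> \<in> X (Suc (Suc m))" by (rule degen_in_nerve[OF \<sigma>]) simp
      note ts\<sigma> = F(1)[OF s\<sigma>]
      fix j assume j: "j \<le> Suc (Suc m)"
      consider "j = 0" | "j = 1" | "j \<ge> 2" by linarith
      then show "d j (s (Suc m) 0 (t (Suc m) \<sigma>)) =
          d j (t (Suc (Suc m)) (t (Suc (Suc m)) (s (Suc m) (Suc m) \<sigma>)))"
      proof cases
        case 1
        then show ?thesis
          using face_degen_eq(1)[OF F(1)[OF \<sigma>], of 0] face_degen_eq(1)[OF \<sigma>, of "Suc m"]
          by (simp add: F(2)[OF ts\<sigma>] F(3)[OF s\<sigma>])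
      next
        case 2
        then show ?thesis
          using face_degen_eq(2)[OF F(1)[OF \<sigma>], of 0] face_degen_eq(2)[OF \<sigma>, of "Suc m"]
          by (simp add: F(3)[OF ts\<sigma>] F(2)[OF s\<sigma>])
      next
        case 3
        define l where "l = j - 2"
        have l: "j = Suc (Suc l)" "l \<le> m" using 3 j by (simp_all add: l_def)
        have dl: "d l \<sigma> \<in> X m" using face_in_nerve[OF \<sigma>] l by simp
        have "d j (s (Suc m) 0 (t (Suc m) \<sigma>)) = s m 0 (d (Suc l) (t (Suc m) \<sigma>))"
          using face_degen_greater[OF F(1)[OF \<sigma>], of 0 "Suc l"] l by simp
        also have "\<dots> = t (Suc m) (t (Suc m) (s m m (d l \<sigma>)))"
          using F(3)[OF \<sigma>] l IH0[OF dl] by simp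
        also have "s m m (d l \<sigma>) = d l (s (Suc m) (Suc m) \<sigma>)"
          using face_degen_less[OF \<sigma>, of l m] l by simp
        finally show ?thesis
          using l by (simp add: F(3)[OF ts\<sigma>] F(3)[OF s\<sigma>])
      qed
    qed (use False degen_in_nerve F(1) that in auto)
    moreover have "s (Suc m) (Suc i) (t (Suc m) \<sigma>) = t (Suc (Suc m)) (s (Suc m) i \<sigma>)"
      if \<sigma>: "\<sigma> \<in> X (Suc m)" and i: "i \<le> m" for \<sigma> i
    proof (rule nerve_eqI)
      have s\<sigma>: "s (Suc m) i \<sigma> \<in> X (Suc (Suc m))" by (rule degen_in_nerve[OF \<sigma>]) (use i in simp)
      note t\<sigma> = F(1)[OF \<sigma>]
      fix j assume j: "j \<le> Suc (Suc m)"
      consider "j = 0" | "0 < j" "j \<le> i" | "j = Suc i" | "j = Suc (Suc i)" | "j > Suc (Suc i)"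
        by linarith
      then show "d j (s (Suc m) (Suc i) (t (Suc m) \<sigma>)) = d j (t (Suc (Suc m)) (s (Suc m) i \<sigma>))"
      proof cases
        case 1
        have "d (Suc (Suc m)) (s (Suc m) i \<sigma>) = s m i (d (Suc m) \<sigma>)"
          using face_degen_greater[OF \<sigma>, of i "Suc m"] i by simp
        then show ?thesis
          using 1 i face_degen_less[OF t\<sigma>, of 0 i] by (simp add: F(2)[OF \<sigma>] F(2)[OF s\<sigma>])
      next
        case 2
        then obtain r l where r: "i = Suc r" "j = Suc l" "l \<le> r" by (cases i; cases j) auto
        have "s m (Suc r) (t m (d l \<sigma>)) = t (Suc m) (s m r (d l \<sigma>))"
          using IH[of "d l \<sigma>" r] face_in_nerve[OF \<sigma>] r i by simp
        then show ?thesis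
          using i r face_degen_less[OF t\<sigma>, of "Suc l" i] face_degen_less[OF \<sigma>, of l r]
          by (simp add: F(3)[OF \<sigma>] F(3)[OF s\<sigma>[unfolded r]])
      next
        case 3
        then show ?thesis
          using i face_degen_eq(1)[OF t\<sigma>, of "Suc i"] face_degen_eq(1)[OF \<sigma>, of i]
          by (simp add: F(3)[OF s\<sigma>])
      next
        case 4
        then show ?thesis
          using i face_degen_eq(2)[OF t\<sigma>, of "Suc i"] face_degen_eq(2)[OF \<sigma>, of i]
          by (simp add: F(3)[OF s\<sigma>])
      next
        case 5
        define l where "l = j - 2"
        have l: "j = Suc (Suc l)" "i < l" "l \<le> m" using 5 j by (simp_all add: l_def)
        have "s m (Suc i) (t m (d l \<sigma>)) = t (Suc m) (s m i (d l \<sigma>))"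
          using IH[of "d l \<sigma>" i] face_in_nerve[OF \<sigma>] i l by simp
        then show ?thesis
          using l i face_degen_greater[OF t\<sigma>, of "Suc i" "Suc l"] face_degen_greater[OF \<sigma>, of i l]
          by (simp add: F(3)[OF \<sigma>] F(3)[OF s\<sigma>])
      qed
    qed (use False degen_in_nerve F(1) that in auto)
    ultimately show ?thesis by (simp add: duplicial_degens_def less_Suc_eq_le)
  qed (simp add: low)
qed

end

section \<open>From right liftings to a duplicial operator\<close>

text \<open>
  In dimension 2 the value is the mate. From dimension 3 on, all components are prescribed by the
  face relations; for a 3-simplex the triangles \<open>d\<^sub>0, \<dots>, d\<^sub>3\<close> of the value are \<open>\<beta>\<close> and the mates of \<open>\<alpha>\<close>,
  \<open>\<gamma>\<close> and \<open>\<delta>\<close>.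
\<close>

fun lift_rotation :: "('o, 'm, 'c) bicat \<Rightarrow> ('o, 'm, 'c) lifting_data \<Rightarrow> nat \<Rightarrow>
    ('o, 'm, 'c) simplex \<Rightarrow> ('o, 'm, 'c) simplex" where
  "lift_rotation B D 0 \<sigma> = (case \<sigma> of S0 x \<Rightarrow> S0 (t_ob D x) | _ \<Rightarrow> \<sigma>)"
| "lift_rotation B D (Suc 0) \<sigma> = (case \<sigma> of S1 f \<Rightarrow> S1 (t_arr D f) | _ \<Rightarrow> \<sigma>)"
| "lift_rotation B D (Suc (Suc 0)) \<sigma> = (case \<sigma> of
     S2 f g h \<alpha> \<Rightarrow> S2 (t_arr D h) f (t_arr D g) (THE \<tau>. mate B D f g h \<alpha> \<tau>) | _ \<Rightarrow> \<sigma>)"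
| "lift_rotation B D (Suc (Suc (Suc 0))) \<sigma> = (case \<sigma> of
     S3 f g h k l m \<alpha> \<beta> \<gamma> \<delta> \<Rightarrow> S3 (t_arr D m) f g (t_arr D l) k (t_arr D h) \<beta>
       (THE \<tau>. mate B D f l m \<delta> \<tau>) (THE \<tau>. mate B D g h l \<alpha> \<tau>) (THE \<tau>. mate B D k h m \<gamma> \<tau>)
   | _ \<Rightarrow> \<sigma>)"
| "lift_rotation B D (Suc (Suc (Suc (Suc n)))) \<sigma> = SN (map (\<lambda>j.
     if j = 0 then nerve_face B (Suc (Suc (Suc (Suc n)))) \<sigma>
     else lift_rotation B D (Suc (Suc (Suc n))) (nerve_face B (j - 1) \<sigma>)) [0..<n + 5])"

context right_liftings
begin

abbreviation T where "T \<equiv> lift_rotation B D"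
abbreviation mate_of where "mate_of f g h \<alpha> \<equiv> (THE \<tau>. mate B D f g h \<alpha> \<tau>)"

lemma mate_of:
  assumes "S2 f g h \<alpha> \<in> X (Suc (Suc 0))"
  shows "mate B D f g h \<alpha> (mate_of f g h \<alpha>)"
  by (rule theI') (use assms mate_ex1 in auto)

lemma mate_of_eqI:
  assumes "mate B D f g h \<alpha> \<tau>" "S2 f g h \<alpha> \<in> X (Suc (Suc 0))"
  shows "mate_of f g h \<alpha> = \<tau>"
  by (rule the1_equality[OF mate_ex1 assms(1)]) (use assms in auto)

lemma rotation_face_0:
  assumes "\<sigma> \<in> X (Suc n)"
  shows "d 0 (T (Suc n) \<sigma>) = d (Suc n) \<sigma>"
  using assms
proof (cases rule: nerve_cases)
  case (N p \<sigma>s)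
  then show ?thesis by (simp add: nth_append del: upt_Suc)
qed (use assms in \<open>auto\<close>)

lemma rotation_face_Suc:
  assumes "\<sigma> \<in> X (Suc n)" "i \<le> n"
  shows "d (Suc i) (T (Suc n) \<sigma>) = T n (d i \<sigma>)"
  using assms(1)
proof (cases rule: nerve_cases)
  case (1 f)
  then show ?thesis using assms by auto
next
  case (2 f g h \<alpha>)
  then have "i = 0 \<or> i = Suc 0" using assms by auto
  then show ?thesis using 2 by auto
next
  case (3 f g h k l m \<alpha> \<beta> \<gamma> \<delta>)
  then have "i = 0 \<or> i = Suc 0 \<or> i = Suc (Suc 0)" using assms by auto
  then show ?thesis using 3 by auto
next
  case (N p \<sigma>s)
  then show ?thesis using assms by (simp add: nth_append del: upt_Suc)
qed simp

text \<open>
  In dimension 3 this is \<open>mate_pasting\<close>. Above, the prescribed faces match because those of the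
  argument do and the face relations hold one dimension below.
\<close>

lemma rotation_in_nerve:
  assumes "\<sigma> \<in> X n"
  shows "T n \<sigma> \<in> X n"
  using assms
proof (induction n arbitrary: \<sigma>)
  case 0
  then show ?case by auto
next
  case (Suc n)
  show ?case
    using Suc.prems
  proof (cases rule: nerve_cases)
    case (1 f)
    then show ?thesis using Suc.prems by auto
  next
    case (2 f g h \<alpha>)
    then have \<alpha>: "S2 f g h \<alpha> \<in> X (Suc (Suc 0))" using Suc.prems by simp
    then show ?thesis
      using 2 mate_cell[OF mate_of[OF \<alpha>]] S2_ends[OF \<alpha>] by (auto simp: cell_def)
  next
    case (3 f g h k l m \<alpha> \<beta> \<gamma> \<delta>)
    then have \<sigma>: "S3 f g h k l m \<alpha> \<beta> \<gamma> \<delta> \<in> X (Suc (Suc (Suc 0)))" using Suc.prems by simp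
    have \<beta>: "S2 f g k \<beta> \<in> X (Suc (Suc 0))" and \<alpha>: "S2 g h l \<alpha> \<in> X (Suc (Suc 0))"
      and \<delta>: "S2 f l m \<delta> \<in> X (Suc (Suc 0))" and \<gamma>: "S2 k h m \<gamma> \<in> X (Suc (Suc 0))"
      using face_in_nerve[OF \<sigma>, of 3] face_in_nerve[OF \<sigma>, of 0] face_in_nerve[OF \<sigma>, of 1]
        face_in_nerve[OF \<sigma>, of 2] by simp_all
    have "mate_of k h m \<gamma> \<cdot> (\<beta> \<star> idcell B (t_arr D m)) =
        mate_of g h l \<alpha> \<cdot> (idcell B g \<star> mate_of f l m \<delta>) \<cdot> assoc B g f (t_arr D m)"
      by (rule mate_pasting[OF _ _ _ _ _ _ _ _ _ _ mate_of[OF \<alpha>] mate_of[OF \<gamma>] mate_of[OF \<delta>]])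
        (use \<sigma> in \<open>simp_all\<close>)
    then show ?thesis
      using 3 \<sigma> \<beta> S2_ends[OF \<delta>] mate_cell[OF mate_of[OF \<alpha>]] mate_cell[OF mate_of[OF \<gamma>]]
        mate_cell[OF mate_of[OF \<delta>]]
      by (simp add: cell_def)
  next
    case (N p \<sigma>s)
    note \<sigma> = Suc.prems
    have n: "n = Suc (Suc (Suc p))" using N by simp
    obtain \<tau>s where \<tau>s: "T (Suc n) \<sigma> = SN \<tau>s" "length \<tau>s = p + 5" by (simp add: n)
    have \<tau>0: "\<tau>s ! 0 = d (Suc n) \<sigma>" using rotation_face_0[OF \<sigma>] \<tau>s by simp
    have \<tau>Suc: "\<tau>s ! Suc j = T n (d j \<sigma>)" if "j \<le> n" for j
      using rotation_face_Suc[OF \<sigma> that] \<tau>s by simp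
    have "SN \<tau>s \<in> X (Suc (Suc (Suc (Suc p))))"
    proof (rule SN_in_nerve)
      fix j assume "j \<le> p + 4"
      then show "\<tau>s ! j \<in> X (Suc (Suc (Suc p)))"
        using \<tau>0 \<tau>Suc face_in_nerve[OF \<sigma>] Suc.IH by (cases j) (auto simp: n)
    next
      fix i j assume ij: "i \<le> j" "j \<le> p + 3"
      have dj: "d j \<sigma> \<in> X (Suc (Suc (Suc p)))" using face_in_nerve[OF \<sigma>] ij n by simp
      show "d i (\<tau>s ! Suc j) = d j (\<tau>s ! i)"
      proof (cases i)
        case 0
        have "d i (\<tau>s ! Suc j) = d 0 (T (Suc (Suc (Suc p))) (d j \<sigma>))"
          using 0 \<tau>Suc[of j] ij n by simp
        also have "\<dots> = d n (d j \<sigma>)"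
          using rotation_face_0[OF dj] n by simp
        also have "\<dots> = d j (d (Suc n) \<sigma>)"
          by (rule face_face[of _ "Suc (Suc p)", symmetric]) (use \<sigma> ij n in simp_all)
        finally show ?thesis using 0 \<tau>0 by simp
      next
        case i: (Suc r)
        then obtain q where q: "j = Suc q" "r \<le> q" "q \<le> Suc (Suc p)" using ij by (cases j) auto
        have dr: "d r \<sigma> \<in> X (Suc (Suc (Suc p)))"
          using face_in_nerve[OF \<sigma>, of r] q n by simp
        have "d i (\<tau>s ! Suc j) = d (Suc r) (T (Suc (Suc (Suc p))) (d j \<sigma>))"
          using i q \<tau>Suc[of j] n by simp
        also have "\<dots> = T (Suc (Suc p)) (d r (d (Suc q) \<sigma>))"
          using rotation_face_Suc[OF dj, of r] q by simp
        also have "d r (d (Suc q) \<sigma>) = d q (d r \<sigma>)"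
          by (rule face_face[of _ "Suc (Suc p)"]) (use \<sigma> q n in simp_all)
        also have "T (Suc (Suc p)) (d q (d r \<sigma>)) = d (Suc q) (T (Suc (Suc (Suc p))) (d r \<sigma>))"
          using rotation_face_Suc[OF dr, of q] q by simp
        also have "\<dots> = d j (\<tau>s ! i)"
          using i q \<tau>Suc[of r] n by simp
        finally show ?thesis .
      qed
    qed (use \<tau>s in simp)
    then show ?thesis using \<tau>s n by simp
  qed simp
qed

text \<open>
  Duplicial operators are extensional.
\<close>

definition rotation where "rotation n = restrict (T n) (X n)"

lemma rotation_eq [simp]: "\<sigma> \<in> X n \<Longrightarrow> rotation n \<sigma> = T n \<sigma>"
  by (simp add: rotation_def)

lemma rotation_faces: "duplicial_faces rotation"
  unfolding duplicial_faces_def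
  by (simp add: rotation_in_nerve rotation_face_0 rotation_face_Suc face_in_nerve)

text \<open>
  In dimension 1 the two kinds of degeneracy relation are instances of \<open>mate_runit\<close>, and of
  \<open>mate_lunit\<close> followed by \<open>mate_eps\<close>, since \<open>t\<close> is applied twice in the second.
\<close>

lemma rotation_duplicial:
  assumes "normal B D"
  shows "duplicial_structure (nerve B) rotation"
proof -
  have "duplicial_degens rotation 0"
    by (auto simp: duplicial_degens_def)
  moreover have "duplicial_degens rotation (Suc 0)"
  proof -
    have "s (Suc 0) 0 (rotation (Suc 0) (S1 f)) =
          rotation (Suc (Suc 0)) (rotation (Suc (Suc 0)) (s (Suc 0) (Suc 0) (S1 f)))"
      and "s (Suc 0) (Suc 0) (rotation (Suc 0) (S1 f)) =
          rotation (Suc (Suc 0)) (s (Suc 0) 0 (S1 f))" if [simp]: "f \<in> Arr B" for f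
    proof -
      have [simp]: "mate_of f (idarr B (tgt B f)) f (lunit B f) = eps_arr D f"
          "mate_of (t_arr D f) f (eps_ob D (tgt B f)) (eps_arr D f) = runit B (t_arr D f)"
          "mate_of (idarr B (src B f)) f f (runit B f) = lunit B (t_arr D f)"
        by (rule mate_of_eqI; simp add: mate_lunit mate_eps mate_runit assms cell_def)+
      show "s (Suc 0) 0 (rotation (Suc 0) (S1 f)) =
          rotation (Suc (Suc 0)) (rotation (Suc (Suc 0)) (s (Suc 0) (Suc 0) (S1 f)))"
        and "s (Suc 0) (Suc 0) (rotation (Suc 0) (S1 f)) =
          rotation (Suc (Suc 0)) (s (Suc 0) 0 (S1 f))"
        by (simp_all add: cell_def)
    qed
    then show ?thesis
      unfolding duplicial_degens_def by auto
  qed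
  ultimately have "duplicial_degens rotation n" if "n < 2" for n
    using that by (auto simp: less_2_cases_iff)
  then have "duplicial_degens rotation n" for n
    by (rule duplicial_degens_from_low[OF rotation_faces])
  then show ?thesis
    using rotation_faces by (simp add: duplicial_structure_nerve rotation_def)
qed

lemma underlying_rotation:
  assumes "normal B D"
  shows "underlying_liftings B rotation = D"
proof -
  have ext: "t_ob D \<in> extensional (Obj B)" "eps_ob D \<in> extensional (Obj B)"
      "t_arr D \<in> extensional (Arr B)" "eps_arr D \<in> extensional (Arr B)"
    using lifting by (auto simp: lifting_structure_def)
  have [simp]: "mate_of f (idarr B (tgt B f)) f (lunit B f) = eps_arr D f" if [simp]: "f \<in> Arr B" for f
    by (rule mate_of_eqI; simp add: mate_lunit assms cell_def)
  have "(\<lambda>x\<in>Obj B. ob_of (rotation 0 (S0 x))) = t_ob D"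
    by (rule extensionalityI[of _ "Obj B"]) (use ext in auto)
  moreover have "(\<lambda>x\<in>Obj B. arr_of (rotation (Suc 0) (S1 (idarr B x)))) = eps_ob D"
    by (rule extensionalityI[of _ "Obj B"]) (use ext in auto)
  moreover have "(\<lambda>f\<in>Arr B. arr_of (rotation (Suc 0) (S1 f))) = t_arr D"
    by (rule extensionalityI[of _ "Arr B"]) (use ext in auto)
  moreover have "(\<lambda>f\<in>Arr B. cell_of (rotation (Suc (Suc 0))
      (S2 f (idarr B (tgt B f)) f (lunit B f)))) = eps_arr D"
    by (rule extensionalityI[of _ "Arr B"]) (use ext in \<open>auto simp: cell_def\<close>)
  ultimately show ?thesis
    by (simp add: underlying_liftings_def nerve_def numeral_2_eq_2 cong: restrict_cong)
qed

end

section \<open>From a duplicial operator to right liftings\<close>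

locale duplicial_bicategory = bicategory B for B :: "('o, 'm, 'c) bicat" (structure) +
  fixes t :: "nat \<Rightarrow> ('o, 'm, 'c) simplex \<Rightarrow> ('o, 'm, 'c) simplex"
  assumes duplicial: "duplicial_structure (nerve B) t"
begin

abbreviation D where "D \<equiv> underlying_liftings B t"
abbreviation t_cell where "t_cell f g h \<alpha> \<equiv> cell_of (t (Suc (Suc 0)) (S2 f g h \<alpha>))"

lemma t_faces: "duplicial_faces t"
  and t_degens: "\<sigma> \<in> X n \<Longrightarrow> s n 0 (t n \<sigma>) = t (Suc n) (t (Suc n) (s n n \<sigma>))"
    "\<sigma> \<in> X n \<Longrightarrow> i < n \<Longrightarrow> s n (Suc i) (t n \<sigma>) = t (Suc n) (s n i \<sigma>)"
  using duplicial by (auto simp: duplicial_structure_nerve duplicial_degens_def)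

lemmas t_in_nerve = duplicial_faces_simps(1)[OF t_faces]
  and t_face_0 = duplicial_faces_simps(2)[OF t_faces]
  and t_face_Suc = duplicial_faces_simps(3)[OF t_faces]

lemma t_0 [simp]:
  assumes "x \<in> Obj B"
  shows "t 0 (S0 x) = S0 (t_ob D x)" "t_ob D x \<in> Obj B"
  using t_in_nerve[of "S0 x" 0] assms by (auto simp: underlying_liftings_def)

lemma t_1 [simp]:
  assumes "f \<in> Arr B"
  shows "t (Suc 0) (S1 f) = S1 (t_arr D f)" "t_arr D f \<in> Arr B"
    "src B (t_arr D f) = t_ob D (tgt B f)" "tgt B (t_arr D f) = src B f"
proof -
  show *: "t (Suc 0) (S1 f) = S1 (t_arr D f)" and "t_arr D f \<in> Arr B"
    using t_in_nerve[of "S1 f" "Suc 0"] assms by (auto simp: underlying_liftings_def)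
  show "src B (t_arr D f) = t_ob D (tgt B f)" "tgt B (t_arr D f) = src B f"
    using t_face_0[of "S1 f" 0] t_face_Suc[of "S1 f" 0 0] assms * by simp_all
qed

lemma t_2:
  assumes \<alpha>: "S2 f g h \<alpha> \<in> X (Suc (Suc 0))"
  shows "t (Suc (Suc 0)) (S2 f g h \<alpha>) = S2 (t_arr D h) f (t_arr D g) (t_cell f g h \<alpha>)"
    "t_cell f g h \<alpha> \<in> Cell B" "csrc B (t_cell f g h \<alpha>) = f \<odot> t_arr D h"
    "ctgt B (t_cell f g h \<alpha>) = t_arr D g"
proof -
  obtain f' g' h' \<alpha>' where \<alpha>': "t (Suc (Suc 0)) (S2 f g h \<alpha>) = S2 f' g' h' \<alpha>'"
    using t_in_nerve[OF \<alpha>] by (cases rule: nerve_cases) auto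
  have "g' = f" "h' = t_arr D g" "f' = t_arr D h"
    using t_face_0[OF \<alpha>] t_face_Suc[OF \<alpha>, of 0] t_face_Suc[OF \<alpha>, of "Suc 0"] \<alpha> \<alpha>' S2_ends[OF \<alpha>]
    by simp_all
  then show "t (Suc (Suc 0)) (S2 f g h \<alpha>) = S2 (t_arr D h) f (t_arr D g) (t_cell f g h \<alpha>)"
    "t_cell f g h \<alpha> \<in> Cell B" "csrc B (t_cell f g h \<alpha>) = f \<odot> t_arr D h"
    "ctgt B (t_cell f g h \<alpha>) = t_arr D g"
    using t_in_nerve[OF \<alpha>] \<alpha>' by (simp_all add: cell_def)
qed

text \<open>
  The value of \<open>t\<close> on a 3-simplex has the rotated triangles as faces; being a 3-simplex of the nerve, it
  satisfies its own compatibility equation.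
\<close>

lemma t_cell_pasting:
  assumes \<sigma>: "S3 f g h k l m \<alpha> \<beta> \<gamma> \<delta> \<in> X (Suc (Suc (Suc 0)))"
  shows "t_cell k h m \<gamma> \<cdot> (\<beta> \<star> idcell B (t_arr D m)) =
    t_cell g h l \<alpha> \<cdot> (idcell B g \<star> t_cell f l m \<delta>) \<cdot> assoc B g f (t_arr D m)"
proof -
  have \<alpha>: "S2 g h l \<alpha> \<in> X (Suc (Suc 0))" and \<gamma>: "S2 k h m \<gamma> \<in> X (Suc (Suc 0))"
    and \<delta>: "S2 f l m \<delta> \<in> X (Suc (Suc 0))"
    using face_in_nerve[OF \<sigma>, of 0] face_in_nerve[OF \<sigma>, of 1] face_in_nerve[OF \<sigma>, of 2] by simp_all
  note t\<sigma> = t_in_nerve[OF \<sigma>]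
  obtain f' g' h' k' l' m' \<alpha>' \<beta>' \<gamma>' \<delta>'
    where \<sigma>': "t (Suc (Suc (Suc 0))) (S3 f g h k l m \<alpha> \<beta> \<gamma> \<delta>) = S3 f' g' h' k' l' m' \<alpha>' \<beta>' \<gamma>' \<delta>'"
    using t\<sigma> by (cases rule: nerve_cases) auto
  have "S2 k' h' m' \<gamma>' = t (Suc (Suc 0)) (S2 g h l \<alpha>)"
    using t_face_Suc[OF \<sigma>, of 0] \<sigma>' by simp
  also have "\<dots> = S2 (t_arr D l) g (t_arr D h) (t_cell g h l \<alpha>)"
    by (rule t_2(1)[OF \<alpha>])
  finally have 1: "h' = g" "\<gamma>' = t_cell g h l \<alpha>" by simp_all
  have "S2 f' l' m' \<delta>' = t (Suc (Suc 0)) (S2 k h m \<gamma>)"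
    using t_face_Suc[OF \<sigma>, of "Suc 0"] \<sigma>' by simp
  also have "\<dots> = S2 (t_arr D m) k (t_arr D h) (t_cell k h m \<gamma>)"
    by (rule t_2(1)[OF \<gamma>])
  finally have 2: "f' = t_arr D m" "\<delta>' = t_cell k h m \<gamma>" by simp_all
  have "S2 f' g' k' \<beta>' = t (Suc (Suc 0)) (S2 f l m \<delta>)"
    using t_face_Suc[OF \<sigma>, of "Suc (Suc 0)"] \<sigma>' by simp
  also have "\<dots> = S2 (t_arr D m) f (t_arr D l) (t_cell f l m \<delta>)"
    by (rule t_2(1)[OF \<delta>])
  finally have 3: "g' = f" "\<beta>' = t_cell f l m \<delta>" by simp_all
  have "\<alpha>' = \<beta>" using t_face_0[OF \<sigma>] \<sigma>' by simp
  then show ?thesis using t\<sigma> \<sigma>' 1 2 3 by simp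
qed

lemma eps_ob_eq [simp]: "x \<in> Obj B \<Longrightarrow> eps_ob D x = t_arr D (idarr B x)"
  by (simp add: underlying_liftings_def nerve_def del: t_1(1))

lemma eps_arr_eq: "f \<in> Arr B \<Longrightarrow> eps_arr D f = t_cell f (idarr B (tgt B f)) f (lunit B f)"
  by (simp add: underlying_liftings_def nerve_def numeral_2_eq_2 del: t_1(1))

lemma t_t_idarr [simp]:
  "x \<in> Obj B \<Longrightarrow> t_arr D (t_arr D (idarr B x)) = idarr B (t_ob D x)"
  using t_degens(1)[of "S0 x" 0] by simp

lemma eps_arr_simps [simp]:
  assumes [simp]: "f \<in> Arr B"
  shows "eps_arr D f \<in> Cell B" "csrc B (eps_arr D f) = f \<odot> t_arr D f"
    "ctgt B (eps_arr D f) = t_arr D (idarr B (tgt B f))"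
  using t_2[of f "idarr B (tgt B f)" f "lunit B f"] by (simp_all add: eps_arr_eq cell_def)

text \<open>
  The relation \<open>t\<^sub>2 s\<^sub>0 = s\<^sub>1 t\<^sub>1\<close>.
\<close>

lemma t_cell_runit:
  assumes [simp]: "f \<in> Arr B"
  shows "t_cell (idarr B (src B f)) f f (runit B f) = lunit B (t_arr D f)"
  using arg_cong[OF t_degens(2)[of "S1 f" "Suc 0" 0], of cell_of] by simp

text \<open>
  The relation \<open>t\<^sub>2 t\<^sub>2 s\<^sub>1 = s\<^sub>0 t\<^sub>1\<close>, as \<open>\<epsilon>\<^sub>f\<close> is the 2-cell of \<open>t\<^sub>2 s\<^sub>1 f\<close>.
\<close>

lemma t_cell_eps:
  assumes [simp]: "f \<in> Arr B"
  shows "t_cell (t_arr D f) f (t_arr D (idarr B (tgt B f))) (eps_arr D f) = runit B (t_arr D f)"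
proof -
  have "t (Suc (Suc 0)) (S2 f (idarr B (tgt B f)) f (lunit B f)) =
      S2 (t_arr D f) f (t_arr D (idarr B (tgt B f))) (eps_arr D f)"
    using t_2(1)[of f "idarr B (tgt B f)" f "lunit B f"] by (simp add: eps_arr_eq cell_def)
  then show ?thesis
    using arg_cong[OF t_degens(1)[of "S1 f" "Suc 0"], of cell_of] by simp
qed

text \<open>
  The two degeneracies of an identity arrow coincide, as \<open>lunit = runit\<close> there. Hence \<open>t_cell_runit\<close>
  also computes \<open>\<epsilon>\<close> at an identity.
\<close>

lemma eps_idarr:
  assumes [simp]: "x \<in> Obj B"
  shows "eps_arr D (idarr B x) = lunit B (t_arr D (idarr B x))"
  using t_cell_runit[of "idarr B x"] by (simp add: eps_arr_eq lunit_idarr)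

lemma eps_t_idarr:
  assumes [simp]: "x \<in> Obj B"
  shows "eps_arr D (t_arr D (idarr B x)) = runit B (t_arr D (idarr B x))"
  using t_cell_eps[of "idarr B x"] by (simp add: eps_arr_eq[of "t_arr D (idarr B x)"] eps_idarr)

text \<open>
  Pasting for the degenerate 3-simplex \<open>s\<^sub>2 \<alpha>\<close>.
\<close>

lemma t_cell_mate:
  assumes \<alpha>: "S2 f g h \<alpha> \<in> X (Suc (Suc 0))"
  shows "mate B D f g h \<alpha> (t_cell f g h \<alpha>)"
proof -
  have "S3 f g (idarr B (tgt B g)) h g h (lunit B g) \<alpha> (lunit B h) \<alpha> \<in> X (Suc (Suc (Suc 0)))"
    using degen_in_nerve[OF \<alpha>, of 2] by simp
  from t_cell_pasting[OF this] show ?thesis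
    using t_2[OF \<alpha>] \<alpha> S2_ends[OF \<alpha>] by (simp add: mate_def cell_def eps_arr_eq)
qed

text \<open>
  Factorisations \<open>\<kappa>\<close> of \<open>\<beta>\<close> through \<open>\<epsilon>\<^sub>f\<close> are, up to the isomorphism \<open>runit\<close>, the same as the mate of
  \<open>\<beta>\<close>, which is a single 2-cell; this contains both existence and uniqueness in the universal
  property. That the mate gives a factorisation is \<open>t_cell_mate\<close>. For the converse, a factorisation
  makes \<open>\<beta>\<close>, \<open>\<epsilon>\<^sub>f\<close> and two cells built from right units into a 3-simplex, and pasting expresses
  the mate of \<open>\<beta>\<close> by \<open>\<kappa>\<close> and the mates of \<open>\<epsilon>\<^sub>f\<close> and of \<open>runit\<close>, which are unit constraints.
\<close>

lemma t_cell_through_eps_iff: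
  assumes [simp]: "f \<in> Arr B" "k \<in> Arr B" "src B k = t_ob D (tgt B f)" "tgt B k = src B f"
    and \<kappa> [simp]: "\<kappa> \<in> Cell B" "csrc B \<kappa> = k" "ctgt B \<kappa> = t_arr D f"
    and \<beta> [simp]: "\<beta> \<in> Cell B" "csrc B \<beta> = f \<odot> k" "ctgt B \<beta> = t_arr D (idarr B (tgt B f))"
  shows "eps_arr D f \<cdot> (idcell B f \<star> \<kappa>) = \<beta> \<longleftrightarrow>
    \<kappa> \<cdot> runit B k = t_cell k f (t_arr D (idarr B (tgt B f))) \<beta>" (is "?P \<longleftrightarrow> ?Q")
proof -
  let ?x = "tgt B f"
  let ?\<epsilon> = "t_arr D (idarr B ?x)" and ?i = "idarr B (t_ob D ?x)"
  let ?t\<beta> = "t_cell k f ?\<epsilon> \<beta>"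
  have \<beta>_in: "S2 k f ?\<epsilon> \<beta> \<in> X (Suc (Suc 0))" by (simp add: cell_def)
  note [simp] = t_2(2-4)[OF \<beta>_in]
  have nat: "runit B ?\<epsilon> \<cdot> (\<beta> \<star> idcell B ?i) = \<beta> \<cdot> runit B (f \<odot> k)"
    by (rule runit_natural') auto
  show ?thesis
  proof
    assume P: ?P
    have "\<beta> \<cdot> runit B (f \<odot> k) = eps_arr D f \<cdot> (idcell B f \<star> \<kappa>) \<cdot>
        ((idcell B f \<star> runit B k) \<cdot> assoc B f k ?i)"
      by (simp add: runit_comp flip: P)
    \<comment> \<open>The faces of this 3-simplex are \<open>\<beta>\<close>, \<open>\<epsilon>\<^sub>f\<close>, a right unit, and \<open>\<kappa>\<close> made into a cell on \<open>k \<odot> 1\<close>.\<close>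
    then have "S3 ?i k f (t_arr D f) ?\<epsilon> ?\<epsilon> \<beta> (\<kappa> \<cdot> runit B k) (eps_arr D f) (runit B ?\<epsilon>)
        \<in> X (Suc (Suc (Suc 0)))"
      using nat by (simp add: cell_def whisker_vcomp)
    from t_cell_pasting[OF this]
    have "runit B (t_arr D f) \<cdot> ((\<kappa> \<cdot> runit B k) \<star> idcell B ?i) =
        ?t\<beta> \<cdot> (idcell B k \<star> t_cell ?i ?\<epsilon> ?\<epsilon> (runit B ?\<epsilon>)) \<cdot> assoc B k ?i ?i"
      by (simp add: t_cell_eps)
    also have "t_cell ?i ?\<epsilon> ?\<epsilon> (runit B ?\<epsilon>) = lunit B ?i"
      using t_cell_runit[of ?\<epsilon>] by simp
    also have "(idcell B k \<star> lunit B ?i) \<cdot> assoc B k ?i ?i = runit B k \<star> idcell B ?i"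
      by (rule triangle') auto
    also have "runit B (t_arr D f) \<cdot> ((\<kappa> \<cdot> runit B k) \<star> idcell B ?i) =
        (\<kappa> \<cdot> runit B k) \<cdot> runit B (k \<odot> ?i)"
      by (rule runit_natural') auto
    also have "\<dots> = \<kappa> \<cdot> (runit B k \<cdot> runit B (k \<odot> ?i))" by simp
    also have "runit B k \<cdot> runit B (k \<odot> ?i) = runit B k \<cdot> (runit B k \<star> idcell B ?i)"
      by (rule runit_natural'[symmetric]) auto
    finally have "(\<kappa> \<cdot> runit B k) \<cdot> (runit B k \<star> idcell B ?i) = ?t\<beta> \<cdot> (runit B k \<star> idcell B ?i)"
      by simp
    then show ?Q
      by (rule iso_cancel_right[OF iso_whisker_right[OF runit_iso'], rotated -1])
        (auto simp: cell_def)
  next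
    assume Q: ?Q
    have "(eps_arr D f \<cdot> (idcell B f \<star> \<kappa>)) \<cdot> runit B (f \<odot> k) =
        (eps_arr D f \<cdot> (idcell B f \<star> \<kappa>)) \<cdot> ((idcell B f \<star> runit B k) \<cdot> assoc B f k ?i)"
      by (simp add: runit_comp)
    also have "\<dots> = eps_arr D f \<cdot> (idcell B f \<star> ?t\<beta>) \<cdot> assoc B f k ?i"
      by (simp add: whisker_vcomp flip: Q)
    also have "\<dots> = \<beta> \<cdot> runit B (f \<odot> k)"
      using t_cell_mate[OF \<beta>_in] nat by (simp add: mate_def eps_t_idarr)
    finally show ?P
      by (rule iso_cancel_right[OF runit_iso', rotated -1]) (auto simp: cell_def)
  qed
qed

lemma right_lifting_eps:
  assumes [simp]: "f \<in> Arr B"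
  shows "right_lifting B (t_arr D f) (t_arr D (idarr B (tgt B f))) f (eps_arr D f)"
proof -
  let ?\<epsilon> = "t_arr D (idarr B (tgt B f))"
  have "\<exists>!\<kappa>. cell B \<kappa> k (t_arr D f) \<and> \<beta> = eps_arr D f \<cdot> (idcell B f \<star> \<kappa>)"
    if k: "arrow B k (t_ob D (tgt B f)) (src B f)" and \<beta>: "cell B \<beta> (f \<odot> k) ?\<epsilon>" for k \<beta>
  proof -
    have [simp]: "k \<in> Arr B" "src B k = t_ob D (tgt B f)" "tgt B k = src B f"
        "\<beta> \<in> Cell B" "csrc B \<beta> = f \<odot> k" "ctgt B \<beta> = ?\<epsilon>"
      using k \<beta> by (auto simp: arrow_def cell_def)
    let ?t\<beta> = "t_cell k f ?\<epsilon> \<beta>"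
    have "S2 k f ?\<epsilon> \<beta> \<in> X (Suc (Suc 0))" by (simp add: cell_def)
    note [simp] = t_2(2-4)[OF this]
    note iff = t_cell_through_eps_iff[of f k _ \<beta>]
    obtain r where [simp]: "r \<in> Cell B" "csrc B r = k" "ctgt B r = k \<odot> idarr B (src B k)"
        "r \<cdot> runit B k = idcell B (k \<odot> idarr B (src B k))"
      using runit_iso'[of k] by (auto simp: iso_cell_def cell_def)
    show ?thesis
    proof (rule ex1I[of _ "?t\<beta> \<cdot> r"])
      show "cell B (?t\<beta> \<cdot> r) k (t_arr D f) \<and> \<beta> = eps_arr D f \<cdot> (idcell B f \<star> (?t\<beta> \<cdot> r))"
        using iff[of "?t\<beta> \<cdot> r"] by (simp add: cell_def)
    next
      fix \<kappa> assume "cell B \<kappa> k (t_arr D f) \<and> \<beta> = eps_arr D f \<cdot> (idcell B f \<star> \<kappa>)"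
      then have \<kappa>: "cell B \<kappa> k (t_arr D f)" "eps_arr D f \<cdot> (idcell B f \<star> \<kappa>) = \<beta>" by auto
      then have "\<kappa> \<cdot> runit B k = (?t\<beta> \<cdot> r) \<cdot> runit B k"
        using iff[of \<kappa>] by (simp add: cell_def)
      then show "\<kappa> = ?t\<beta> \<cdot> r"
        by (rule iso_cancel_right[OF runit_iso', rotated -1]) (use \<kappa> in \<open>auto simp: cell_def\<close>)
    qed
  qed
  then show ?thesis
    unfolding right_lifting_def
    by (intro exI[of _ "t_ob D (tgt B f)"] exI[of _ "src B f"] exI[of _ "tgt B f"])
      (simp add: arrow_def cell_def)
qed

lemma underlying_lifting_structure: "lifting_structure B D"
proof -
  have "t_ob D \<in> extensional (Obj B)" "eps_ob D \<in> extensional (Obj B)"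
      "t_arr D \<in> extensional (Arr B)" "eps_arr D \<in> extensional (Arr B)"
    by (simp_all add: underlying_liftings_def)
  then show ?thesis
    unfolding lifting_structure_def
    by (auto simp: arrow_def cell_def right_lifting_eps eps_t_idarr)
qed

lemma underlying_normal: "normal B D"
  by (simp add: normal_def eps_idarr)

end

section \<open>The correspondence\<close>

context bicategory
begin

text \<open>
  The lifting data contain \<open>t\<close> in dimensions 0 and 1. They are right liftings, so that 2-cells are
  recovered as unique mates, and the higher dimensions from faces.
\<close>

lemma inj_on_underlying_liftings:
  "inj_on (underlying_liftings B) {t. duplicial_structure (nerve B) t}"
proof (rule inj_onI)
  fix t t' assume "t \<in> {t. duplicial_structure (nerve B) t}" "t' \<in> {t. duplicial_structure (nerve B) t}"
  then have t: "duplicial_structure (nerve B) t" and t': "duplicial_structure (nerve B) t'"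
    by auto
  assume eq: "underlying_liftings B t = underlying_liftings B t'"
  interpret t: duplicial_bicategory B t by unfold_locales (rule t)
  interpret t': duplicial_bicategory B t' by unfold_locales (rule t')
  interpret right_liftings B "underlying_liftings B t"
    by unfold_locales (rule t.underlying_lifting_structure)
  have "t n \<sigma> = t' n \<sigma>" if \<sigma>: "\<sigma> \<in> X n" "n \<le> 2" for n \<sigma>
    using \<sigma>(1)
  proof (cases rule: nerve_cases)
    case (0 x)
    then show ?thesis using \<sigma> t.t_0(1)[of x] t'.t_0(1)[of x] eq by auto
  next
    case (1 f)
    then show ?thesis using \<sigma> t.t_1(1)[of f] t'.t_1(1)[of f] eq by auto
  next
    case (2 f g h \<alpha>)
    then have \<alpha>: "S2 f g h \<alpha> \<in> X (Suc (Suc 0))" using \<sigma> by simp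
    have "t.t_cell f g h \<alpha> = t'.t_cell f g h \<alpha>"
      using t.t_cell_mate[OF \<alpha>] t'.t_cell_mate[OF \<alpha>] mate_ex1[of f g \<alpha> h] \<alpha> eq by auto
    then show ?thesis using 2 t.t_2(1)[OF \<alpha>] t'.t_2(1)[OF \<alpha>] eq by simp
  qed (use \<sigma> in auto)
  then have *: "t n \<sigma> = t' n \<sigma>" if "\<sigma> \<in> X n" for n \<sigma>
    using duplicial_faces_unique[OF t.t_faces t'.t_faces _ that] by blast
  have "t n = t' n" for n
    by (rule extensionalityI[of _ "X n"]) (use t t' * in \<open>auto simp: duplicial_structure_nerve\<close>)
  then show "t = t'" by blast
qed

lemma bij_betw_underlying_liftings:
  "bij_betw (underlying_liftings B) {t. duplicial_structure (nerve B) t}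
     {D. lifting_structure B D \<and> normal B D}"
  unfolding bij_betw_def
proof (intro conjI equalityI subsetI inj_on_underlying_liftings)
  fix D assume "D \<in> underlying_liftings B ` {t. duplicial_structure (nerve B) t}"
  then obtain t where t: "duplicial_structure (nerve B) t" "D = underlying_liftings B t" by blast
  interpret duplicial_bicategory B t by unfold_locales (rule t)
  show "D \<in> {D. lifting_structure B D \<and> normal B D}"
    using underlying_lifting_structure underlying_normal t(2) by simp
next
  fix D assume "D \<in> {D. lifting_structure B D \<and> normal B D}"
  then have D: "lifting_structure B D" "normal B D" by auto
  interpret right_liftings B D by unfold_locales (rule D)
  show "D \<in> underlying_liftings B ` {t. duplicial_structure (nerve B) t}"
    using rotation_duplicial[OF D(2)] underlying_rotation[OF D(2)] by force
qed

text \<open>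
  By naturality of \<open>lunit\<close>, the factorisation of \<open>\<beta>\<close> is \<open>\<beta>\<close> after the inverse of \<open>lunit\<close>.
\<close>

lemma right_lifting_lunit:
  assumes [simp]: "f \<in> Arr B"
  shows "right_lifting B f f (idarr B (tgt B f)) (lunit B f)"
proof -
  let ?i = "idarr B (tgt B f)"
  have "\<exists>!\<kappa>. cell B \<kappa> k f \<and> \<beta> = lunit B f \<cdot> (idcell B ?i \<star> \<kappa>)"
    if k: "arrow B k (src B f) (tgt B f)" and \<beta>: "cell B \<beta> (?i \<odot> k) f" for k \<beta>
  proof -
    have [simp]: "k \<in> Arr B" "src B k = src B f" "tgt B k = tgt B f"
        "\<beta> \<in> Cell B" "csrc B \<beta> = ?i \<odot> k" "ctgt B \<beta> = f"
      using k \<beta> by (auto simp: arrow_def cell_def)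
    have lunit: "lunit B f \<cdot> (idcell B ?i \<star> \<kappa>) = \<kappa> \<cdot> lunit B k" if "cell B \<kappa> k f" for \<kappa>
      by (rule lunit_natural') (use that in \<open>auto simp: cell_def\<close>)
    obtain r where [simp]: "r \<in> Cell B" "csrc B r = k" "ctgt B r = ?i \<odot> k"
        "r \<cdot> lunit B k = idcell B (?i \<odot> k)"
      using lunit_iso'[of k] by (auto simp: iso_cell_def cell_def)
    show ?thesis
    proof (rule ex1I[of _ "\<beta> \<cdot> r"])
      show "cell B (\<beta> \<cdot> r) k f \<and> \<beta> = lunit B f \<cdot> (idcell B ?i \<star> (\<beta> \<cdot> r))"
        using lunit[of "\<beta> \<cdot> r"] by (simp add: cell_def)
    next
      fix \<kappa> assume "cell B \<kappa> k f \<and> \<beta> = lunit B f \<cdot> (idcell B ?i \<star> \<kappa>)"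
      then have \<kappa>: "cell B \<kappa> k f" "\<kappa> \<cdot> lunit B k = \<beta>" using lunit[of \<kappa>] by auto
      then have "\<kappa> \<cdot> lunit B k = (\<beta> \<cdot> r) \<cdot> lunit B k"
        by simp
      then show "\<kappa> = \<beta> \<cdot> r"
        by (rule iso_cancel_right[OF lunit_iso', rotated -1]) (use \<kappa> in \<open>auto simp: cell_def\<close>)
    qed
  qed
  then show ?thesis
    unfolding right_lifting_def
    by (intro exI[of _ "src B f"] exI[of _ "tgt B f"]) (simp add: arrow_def cell_def)
qed

lemma normal_normalise: "normal B (normalise B D)"
  by (simp add: normal_def normalise_def)

text \<open>
  At identity arrows the new 2-cells are right liftings by \<open>right_lifting_lunit\<close>. The condition on \<open>\<epsilon>\<close>
  at \<open>\<epsilon>\<^sub>x\<close> is affected only if \<open>\<epsilon>\<^sub>x\<close> is itself an identity, where \<open>lunit = runit\<close>.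
\<close>

lemma lifting_structure_normalise:
  assumes "lifting_structure B D"
  shows "lifting_structure B (normalise B D)"
proof -
  interpret right_liftings B D by unfold_locales (rule assms)
  let ?N = "normalise B D"
  have [simp]: "t_ob ?N = t_ob D" "eps_ob ?N = eps_ob D" "t_arr ?N = t_arr D"
    by (simp_all add: normalise_def)
  have "eps_arr ?N \<in> extensional (Arr B)"
    using lifting by (auto simp: lifting_structure_def normalise_def extensional_def)
  moreover have "cell B (eps_arr ?N f) (f \<odot> t_arr D f) (eps_ob D (tgt B f)) \<and>
      right_lifting B (t_arr D f) (eps_ob D (tgt B f)) f (eps_arr ?N f)" if "f \<in> Arr B" for f
  proof (cases "f \<in> idarr B ` Obj B")
    case True
    then obtain x where "x \<in> Obj B" "f = idarr B x" by blast
    then show ?thesis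
      using right_lifting_lunit[of "eps_ob D x"] by (auto simp: normalise_def cell_def)
  next
    case False
    then show ?thesis
      using lifting that by (auto simp: normalise_def lifting_structure_def arrow_def)
  qed
  moreover have "eps_arr ?N (eps_ob D x) = runit B (eps_ob D x)" if x: "x \<in> Obj B" for x
  proof (cases "eps_ob D x \<in> idarr B ` Obj B")
    case True
    then have \<epsilon>: "eps_ob D x = idarr B x" using ob_simps(4)[OF x] by auto
    then have "eps_arr ?N (eps_ob D x) = lunit B (idarr B x)"
      using x by (auto simp: normalise_def)
    then show ?thesis using \<epsilon> x by (simp add: lunit_idarr)
  next
    case False
    then show ?thesis using x by (simp add: normalise_def)
  qed
  ultimately show ?thesis
    using lifting unfolding lifting_structure_def by (auto simp: arrow_def)
qed

end

theorem theorem5p6: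
  fixes B :: "('o, 'm, 'c) bicat"
  assumes "bicategory B"
  shows "bij_betw (underlying_liftings B)
           {t. duplicial_structure (nerve B) t}
           {D. lifting_structure B D \<and> normal B D} \<and>
         (\<forall>D. lifting_structure B D \<longrightarrow>
           (\<exists>!t. duplicial_structure (nerve B) t \<and> underlying_liftings B t = normalise B D))"
proof (intro conjI allI impI)
  interpret bicategory B by (rule assms)
  show bij: "bij_betw (underlying_liftings B) {t. duplicial_structure (nerve B) t}
      {D. lifting_structure B D \<and> normal B D}"
    by (rule bij_betw_underlying_liftings)
  fix D assume "lifting_structure B D"
  then have "normalise B D \<in> underlying_liftings B ` {t. duplicial_structure (nerve B) t}"
    using bij lifting_structure_normalise normal_normalise by (auto simp: bij_betw_def)
  then show "\<exists>!t. duplicial_structure (nerve B) t \<and> underlying_liftings B t = normalise B D"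
    using inj_on_underlying_liftings by (auto simp: inj_on_def)
qed

end
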